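(* Let $g\ge2$ and $d\in\mathbb N$. If $f\in\mathbb C\langle X_1,\dots,X_g,X_1^{\intercal},\dots,X_g^{\intercal}\rangle$ of degree $d-1$ is nonnegative on all spherical isometries of size $(2g+1)^d$, then $$f=\sum_j p_j^{\intercal}p_j+q$$ for some (finitely many) $p_j\in\mathbb C\langle X_1,\dots,X_g,X_1^{\intercal},\dots,X_g^{\intercal}\rangle$ of degrees at most $d$ and some $q$ in the two-sided ideal $(1-X_1^{\intercal}X_1-\cdots-X_g^{\intercal}X_g)$.
   Context: $\mathbb C\langle X_1,\dots,X_g,X_1^{\intercal},\dots,X_g^{\intercal}\rangle$ is the free associative unital $\mathbb C$-algebra in $2g$ freely noncommuting letters with the conjugate-linear involution ${}^{\intercal}$ (an antiautomorphism) exchanging $X_j$ and $X_j^{\intercal}$. The evaluation of $f$ at $A\in M_n(\mathbb C)^g$ replaces $X_j$ by $A_j$ and $X_j^{\intercal}$ by the conjugate transpose $A_j^*$. A spherical isometry of size $n$ is a tuple $A\in M_n(\mathbb C)^g$ with $A_1^*A_1+\cdots+A_g^*A_g=I_n$. A polynomial $f$ is nonnegative on a set of matrix tuples if its evaluation at each tuple of the set is a (Hermitian) positive semidefinite matrix. *)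

theory Defs
  imports
    "HOL-Library.Cardinality"
    "HOL-Library.Poly_Mapping"
    "Jordan_Normal_Form.Schur_Decomposition"
begin

section \<open>The free *-algebra\<close>

text \<open>The index type of the variables is a finite type \<open>'g\<close>, so \<open>g\<close> is \<open>CARD('g)\<close>.
  \<open>X j\<close> and \<open>XT j\<close> are the letters for the j-th variable and its formal adjoint.\<close>

datatype 'g letter = X 'g | XT 'g

text \<open>Words form a monoid under concatenation. Written additively, as the convolution product
  of \<^theory>\<open>HOL-Library.Poly_Mapping\<close> requires, this turns finitely supported functions on
  words into the free associative unital algebra.\<close>

instantiation list :: (type) monoid_add
begin

definition zero_list :: "'a list" where "zero_list = []"

definition plus_list :: "'a list \<Rightarrow> 'a list \<Rightarrow> 'a list" where "plus_list u v = u @ v"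

instance by standard (simp_all add: zero_list_def plus_list_def)

end

type_synonym 'g ncpoly = "'g letter list \<Rightarrow>\<^sub>0 complex"

definition nc_gen :: "'g letter \<Rightarrow> 'g ncpoly" where
  "nc_gen x = Poly_Mapping.single [x] 1"

text \<open>The zero polynomial has degree 0 here.\<close>

definition nc_degree :: "'g ncpoly \<Rightarrow> nat" where
  "nc_degree p = Max (insert 0 (length ` Poly_Mapping.keys p))"

fun letter_star :: "'g letter \<Rightarrow> 'g letter" where
  "letter_star (X j) = XT j"
| "letter_star (XT j) = X j"

definition word_star :: "'g letter list \<Rightarrow> 'g letter list" where
  "word_star w = rev (map letter_star w)"

definition nc_star :: "'g ncpoly \<Rightarrow> 'g ncpoly" where
  "nc_star p = (\<Sum>w\<in>Poly_Mapping.keys p.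
     Poly_Mapping.single (word_star w) (cnj (Poly_Mapping.lookup p w)))"

definition two_sided_ideal :: "'a::ring_1 set \<Rightarrow> bool" where
  "two_sided_ideal I \<longleftrightarrow> 0 \<in> I \<and> (\<forall>x\<in>I. \<forall>y\<in>I. x + y \<in> I)
     \<and> (\<forall>a. \<forall>x\<in>I. a * x \<in> I \<and> x * a \<in> I)"

definition spherical_relation :: "'g::finite ncpoly" where
  "spherical_relation = 1 - (\<Sum>j\<in>UNIV. nc_gen (XT j) * nc_gen (X j))"

definition spherical_ideal :: "'g::finite ncpoly set" where
  "spherical_ideal = two_sided_ideal hull {spherical_relation}"


section \<open>Evaluation at matrix tuples\<close>

text \<open>The type of matrices has no zero independent of the size, so finite sums of
  \<open>n \<times> n\<close> matrices are taken entrywise.\<close>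

definition mat_sum :: "nat \<Rightarrow> ('i \<Rightarrow> complex mat) \<Rightarrow> 'i set \<Rightarrow> complex mat" where
  "mat_sum n M I = mat n n (\<lambda>(r, s). \<Sum>i\<in>I. M i $$ (r, s))"

fun letter_eval :: "('g \<Rightarrow> complex mat) \<Rightarrow> 'g letter \<Rightarrow> complex mat" where
  "letter_eval A (X j) = A j"
| "letter_eval A (XT j) = mat_adjoint (A j)"

definition word_eval :: "nat \<Rightarrow> ('g \<Rightarrow> complex mat) \<Rightarrow> 'g letter list \<Rightarrow> complex mat" where
  "word_eval n A w = foldr (\<lambda>x M. letter_eval A x * M) w (1\<^sub>m n)"

definition nc_eval :: "nat \<Rightarrow> ('g \<Rightarrow> complex mat) \<Rightarrow> 'g ncpoly \<Rightarrow> complex mat" where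
  "nc_eval n A p =
     mat_sum n (\<lambda>w. Poly_Mapping.lookup p w \<cdot>\<^sub>m word_eval n A w) (Poly_Mapping.keys p)"

definition spherical_isometry :: "nat \<Rightarrow> ('g::finite \<Rightarrow> complex mat) \<Rightarrow> bool" where
  "spherical_isometry n A \<longleftrightarrow> (\<forall>j. A j \<in> carrier_mat n n)
     \<and> mat_sum n (\<lambda>j. mat_adjoint (A j) * A j) UNIV = 1\<^sub>m n"

definition psd_mat :: "nat \<Rightarrow> complex mat \<Rightarrow> bool" where
  "psd_mat n M \<longleftrightarrow> M \<in> carrier_mat n n \<and> mat_adjoint M = M
     \<and> (\<forall>v\<in>carrier_vec n. 0 \<le> Re ((M *\<^sub>v v) \<bullet>c v))"

definition nc_nonneg_on :: "nat \<Rightarrow> ('g \<Rightarrow> complex mat) set \<Rightarrow> 'g ncpoly \<Rightarrow> bool" where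
  "nc_nonneg_on n S p \<longleftrightarrow> (\<forall>A\<in>S. psd_mat n (nc_eval n A p))"

end

theory Submission
  imports Defs
begin

text \<open>
  Suppose that \<open>f\<close> is not a sum of squares of polynomials of degree at most \<open>d\<close> modulo the
  ideal \<open>I\<close> of the spherical relation. Modulo \<open>I\<close> these sums of squares form a closed
  convex cone in a finite-dimensional space, so there is one nearest to \<open>f\<close>, and the residual
  defines a linear functional \<open>L\<close> that vanishes on \<open>I\<close>, is nonnegative on \<open>p\<^sup>* p\<close>
  for \<open>deg p \<le> d\<close>, and satisfies \<open>Re (L f) < 0\<close> (\<open>sos_separation\<close>).

  The Gelfand-Naimark-Segal construction turns the Hermitian part of \<open>L\<close>, again written \<open>L\<close>, into matrices
  (\<open>gns_spherical_isometry\<close>). Let \<open>H\<close> be the space of polynomials of degree at most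
  \<open>d - 1\<close>, with the possibly degenerate inner product \<open>\<langle>p, q\<rangle> = L (q\<^sup>* p)\<close>, and let
  \<open>a\<^sub>j\<close> be multiplication by \<open>x\<^sub>j\<close> followed by the projection back to \<open>H\<close>.
  Multiplication by the column of all \<open>x\<^sub>j\<close> preserves lengths because of the spherical
  relation, so by Bessel's inequality the column of all \<open>a\<^sub>j\<close> is a contraction. On
  polynomials of degree at most \<open>d - 2\<close> nothing is projected away, and there \<open>a\<^sub>j\<close> and its
  adjoint act as multiplication by \<open>x\<^sub>j\<close> and \<open>x\<^sub>j\<^sup>T\<close>. A dilation by the defect of the
  contraction yields a spherical isometry \<open>A\<close> that acts in the same way on these
  polynomials; the second variable is needed to keep the added space orthogonal to the range of the
  defect. Since a word of length at most \<open>d - 1\<close> is then reproduced by applying its letters to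
  the vector of \<open>1\<close>, one gets \<open>\<langle>f(A) 1, 1\<rangle> = L f < 0\<close>, which contradicts nonnegativity. The
  dimension of \<open>H\<close> is at most the number of words of length at most \<open>d - 1\<close>, hence at most
  \<open>(2g + 1)\<^sup>d\<^sup>-\<^sup>1\<close>, and twice that dimension suffices for \<open>A\<close>.

  Closedness of the cone requires that large squares cannot cancel modulo \<open>I\<close>: the coefficients
  of a polynomial in normal form have to be controlled by its values on spherical isometries. For this
  a word is called normal if it does not contain \<open>x\<^sub>i\<^sup>T x\<^sub>i\<close> for one fixed index
  \<open>i\<close>, and every normal word \<open>z\<close> is given a spherical isometry that detects the coefficient of
  \<open>z\<close> among all normal words that are not longer (\<open>path_representation\<close>): the letters of \<open>z\<close>
  act as steps along a path, and the same dilation makes the tuple spherical. These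
  representations give uniqueness of normal forms (\<open>normal_poly_detected\<close>), the bounds needed for
  compactness (\<open>coefficients_bounded\<close>), and \<open>f - f\<^sup>* \<in> I\<close>.
\<close>

section \<open>Degenerate inner products and Gram matrices\<close>

text \<open>Positivity is demanded on a subspace only: the functionals below are nonnegative on squares of
  polynomials of bounded degree, while the form that they define lives on all polynomials.\<close>

locale psd_form = vector_space smul
  for smul :: "complex \<Rightarrow> 'v::ab_group_add \<Rightarrow> 'v" +
  fixes V :: "'v set" and s :: "'v \<Rightarrow> 'v \<Rightarrow> complex"
  assumes subspace_V: "subspace V"
    and s_add_left: "s (x + y) z = s x z + s y z"
    and s_scale_left: "s (smul c x) y = c * s x y"
    and s_hermitian: "s y x = cnj (s x y)"
    and s_nonneg: "x \<in> V \<Longrightarrow> 0 \<le> Re (s x x)"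
begin

lemma s_zero_left [simp]: "s 0 y = 0"
  using s_scale_left[of 0 0 y] by simp

lemma s_uminus_left: "s (- x) y = - s x y"
  using s_scale_left[of "-1" x y] by simp

lemma s_diff_left: "s (x - y) z = s x z - s y z"
  using s_add_left[of x "- y" z] by (simp add: s_uminus_left)

lemma s_sum_left: "s (\<Sum>i\<in>I. f i) z = (\<Sum>i\<in>I. s (f i) z)"
  by (induction I rule: infinite_finite_induct) (auto simp: s_add_left)

lemma s_add_right: "s z (x + y) = s z x + s z y"
  by (metis complex_cnj_add s_add_left s_hermitian)

lemma s_diff_right: "s z (x - y) = s z x - s z y"
  by (metis complex_cnj_diff s_diff_left s_hermitian)

lemma s_scale_right: "s x (smul c y) = cnj c * s x y"
  by (metis complex_cnj_mult s_hermitian s_scale_left)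

lemma s_sum_right: "s z (\<Sum>i\<in>I. f i) = (\<Sum>i\<in>I. s z (f i))"
  by (subst s_hermitian, subst s_sum_left) (simp add: s_hermitian[of _ z])

lemma s_self_real: "s x x = complex_of_real (Re (s x x))"
  using s_hermitian[of x x] by (simp add: complex_eq_iff)

text \<open>Otherwise moving \<open>y\<close> far enough in the direction of \<open>x\<close> would make the quadratic form negative.\<close>

lemma null_vector:
  assumes "x \<in> V" "y \<in> V" "s x x = 0"
  shows "s x y = 0"
proof (rule ccontr)
  define a where "a = s x y"
  assume "s x y \<noteq> 0"
  then have a: "a \<noteq> 0" by (simp add: a_def)
  \<comment> \<open>With this step length the form takes the value \<open>-1\<close> at \<open>y - t (cnj a) x\<close>.\<close>
  define t where "t = (Re (s y y) + 1) / (2 * (cmod a)\<^sup>2)"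
  define c where "c = - (complex_of_real t * cnj a)"
  have yx: "s y x = cnj a" by (simp add: a_def s_hermitian[of y x])
  have "s (y + smul c x) (y + smul c x) = s y y + c * a + cnj c * cnj a"
    using assms(3) yx
    by (simp add: s_add_left s_add_right s_scale_left s_scale_right a_def[symmetric] algebra_simps)
  moreover have "c * a = - complex_of_real (t * (cmod a)\<^sup>2)"
    by (simp add: c_def complex_norm_square[unfolded of_real_power] mult_ac)
  moreover have "cnj c * cnj a = cnj (c * a)" by simp
  ultimately have "Re (s (y + smul c x) (y + smul c x)) = Re (s y y) - 2 * (t * (cmod a)\<^sup>2)"
    by simp
  also have "\<dots> = -1" using a by (simp add: t_def field_simps)
  finally show False
    using s_nonneg[of "y + smul c x"] assms subspace_V
    by (simp add: subspace_add subspace_scale)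
qed

definition orthonormal :: "(nat \<Rightarrow> 'v) \<Rightarrow> nat \<Rightarrow> bool" where
  "orthonormal b m \<longleftrightarrow> (\<forall>i<m. b i \<in> V) \<and> (\<forall>i<m. \<forall>k<m. s (b i) (b k) = (if i = k then 1 else 0))"

lemma orthonormalD:
  assumes "orthonormal b m"
  shows "i < m \<Longrightarrow> b i \<in> V" "i < m \<Longrightarrow> k < m \<Longrightarrow> s (b i) (b k) = (if i = k then 1 else 0)"
  using assms by (auto simp: orthonormal_def)

definition residual :: "(nat \<Rightarrow> 'v) \<Rightarrow> nat \<Rightarrow> 'v \<Rightarrow> 'v" where
  "residual b m x = x - (\<Sum>i<m. smul (s x (b i)) (b i))"

lemma residual_in_V: "orthonormal b m \<Longrightarrow> x \<in> V \<Longrightarrow> residual b m x \<in> V"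
  unfolding residual_def
  by (intro subspace_diff subspace_sum subspace_scale subspace_V) (auto simp: orthonormal_def)

lemma s_residual_left: "s (residual b m x) y = s x y - (\<Sum>i<m. s x (b i) * s (b i) y)"
  by (simp add: residual_def s_diff_left s_sum_left s_scale_left)

lemma residual_orthogonal:
  assumes "orthonormal b m" "k < m"
  shows "s (residual b m x) (b k) = 0"
proof -
  have "(\<Sum>i<m. s x (b i) * s (b i) (b k)) = (\<Sum>i<m. if i = k then s x (b k) else 0)"
    using assms by (intro sum.cong) (auto simp: orthonormal_def)
  also have "\<dots> = s x (b k)" using assms by simp
  finally show ?thesis by (simp add: s_residual_left)
qed

lemma s_residual_right:
  assumes "orthonormal b m"
  shows "s (residual b m x) (residual b m y) = s (residual b m x) y"
proof -
  have "s (residual b m x) (\<Sum>i<m. smul (s y (b i)) (b i)) = 0"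
    using assms by (simp add: s_sum_right s_scale_right residual_orthogonal)
  then show ?thesis
    by (subst (2) residual_def) (simp add: s_diff_right)
qed

lemma bessel:
  assumes "orthonormal b m" "x \<in> V"
  shows "(\<Sum>i<m. (cmod (s x (b i)))\<^sup>2) \<le> Re (s x x)"
proof -
  have "0 \<le> Re (s (residual b m x) (residual b m x))"
    using assms by (intro s_nonneg residual_in_V)
  also have "\<dots> = Re (s x x - (\<Sum>i<m. s x (b i) * s (b i) x))"
    by (subst s_residual_right[OF assms(1)], subst s_residual_left) (rule refl)
  also have "(\<Sum>i<m. s x (b i) * s (b i) x) = (\<Sum>i<m. complex_of_real ((cmod (s x (b i)))\<^sup>2))"
    by (intro sum.cong refl) (simp only: s_hermitian[of _ x] complex_norm_square)
  finally show ?thesis by simp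
qed

text \<open>The form may be degenerate, so the vectors are recovered from the orthonormal system only up to
  null vectors, which is expressed by testing against \<open>V\<close>. A vector whose residual is null adds
  nothing to the system; hence \<open>m\<close> may be smaller than the length of the list.\<close>

lemma gram_schmidt:
  assumes "set us \<subseteq> V"
  shows "\<exists>m b. m \<le> length us \<and> orthonormal b m \<and>
           (\<forall>u\<in>set us. \<forall>y\<in>V. s u y = (\<Sum>i<m. s u (b i) * s (b i) y))"
  using assms
proof (induction us)
  case Nil
  show ?case by (rule exI[of _ 0]) (simp add: orthonormal_def)
next
  case (Cons a us)
  then obtain m b where m: "m \<le> length us" and b: "orthonormal b m"
    and expand: "\<And>u y. u \<in> set us \<Longrightarrow> y \<in> V \<Longrightarrow> s u y = (\<Sum>i<m. s u (b i) * s (b i) y)"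
    by auto
  have aV: "a \<in> V" using Cons.prems by simp
  define e where "e = residual b m a"
  have eV: "e \<in> V" unfolding e_def using b aV by (rule residual_in_V)
  have a_expand: "s a y = s e y + (\<Sum>i<m. s a (b i) * s (b i) y)" for y
    by (simp add: e_def s_residual_left)
  show ?case
  proof (cases "s e e = 0")
    case True
    then have a_eq: "s a y = (\<Sum>i<m. s a (b i) * s (b i) y)" if "y \<in> V" for y
      using null_vector[OF eV that] a_expand[of y] by simp
    have "\<forall>u\<in>set (a # us). \<forall>y\<in>V. s u y = (\<Sum>i<m. s u (b i) * s (b i) y)"
      unfolding list.set ball_simps(7) by (intro conjI ballI a_eq expand)
    moreover have "m \<le> length (a # us)" using m by simp
    ultimately show ?thesis using b by blast
  next
    case False
    define r where "r = Re (s e e)"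
    have see: "s e e = complex_of_real r" unfolding r_def by (rule s_self_real)
    have r: "r > 0" using False see s_nonneg[OF eV] unfolding r_def[symmetric] by (cases "r = 0") auto
    define c where "c = complex_of_real (1 / sqrt r)"
    have cc: "c * c * complex_of_real r = 1"
      using r by (simp add: c_def flip: of_real_mult)
    have cnj_c: "cnj c = c" by (simp add: c_def)
    define b' where "b' = b(m := smul c e)"
    have b'_old: "i < m \<Longrightarrow> b' i = b i" for i by (simp add: b'_def)
    have b'_new: "b' m = smul c e" by (simp add: b'_def)
    have e_orth: "i < m \<Longrightarrow> s e (b i) = 0" for i
      unfolding e_def by (rule residual_orthogonal[OF b])
    have e_orth': "i < m \<Longrightarrow> s (b i) e = 0" for i
      using e_orth[of i] s_hermitian[of "b i" e] by simp
    have onb: "orthonormal b' (Suc m)"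
      unfolding orthonormal_def
    proof (intro conjI allI impI)
      fix i assume "i < Suc m"
      then show "b' i \<in> V"
        using b eV subspace_scale[OF subspace_V eV] by (cases "i = m") (auto simp: b'_def orthonormal_def)
    next
      fix i k assume ik: "i < Suc m" "k < Suc m"
      show "s (b' i) (b' k) = (if i = k then 1 else 0)"
      proof (cases "i = m"; cases "k = m")
        assume "i = m" "k = m"
        then show ?thesis using cc
          by (simp add: b'_new s_scale_left s_scale_right cnj_c see mult_ac)
      next
        assume "i = m" "k \<noteq> m"
        then show ?thesis using ik by (simp add: b'_new b'_old s_scale_left e_orth)
      next
        assume "i \<noteq> m" "k = m"
        then show ?thesis using ik by (simp add: b'_new b'_old s_scale_right e_orth')
      next
        assume "i \<noteq> m" "k \<noteq> m"
        then show ?thesis using ik b by (simp add: b'_old orthonormal_def)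
      qed
    qed
    have sum_old: "(\<Sum>i<m. s u (b' i) * s (b' i) y) = (\<Sum>i<m. s u (b i) * s (b i) y)" for u y
      by (intro sum.cong) (auto simp: b'_old)
    have us_eq: "s u y = (\<Sum>i<Suc m. s u (b' i) * s (b' i) y)" if "u \<in> set us" "y \<in> V" for u y
    proof -
      have "s u e = 0" using expand[OF that(1) eV] by (simp add: e_orth')
      then show ?thesis using expand[OF that] by (simp add: sum_old b'_new s_scale_right)
    qed
    have a_eq: "s a y = (\<Sum>i<Suc m. s a (b' i) * s (b' i) y)" for y
    proof -
      have "s a e = s e e" using a_expand[of e] by (simp add: e_orth')
      then have "s a (b' m) * s (b' m) y = (c * c * complex_of_real r) * s e y"
        by (simp add: b'_new s_scale_right s_scale_left cnj_c see)
      then show ?thesis using a_expand[of y] by (simp only: cc sum.lessThan_Suc sum_old) simp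
    qed
    have "\<forall>u\<in>set (a # us). \<forall>y\<in>V. s u y = (\<Sum>i<Suc m. s u (b' i) * s (b' i) y)"
      unfolding list.set ball_simps(7) by (intro conjI ballI a_eq us_eq)
    moreover have "Suc m \<le> length (a # us)" using m by simp
    ultimately show ?thesis using onb by blast
  qed
qed

end

definition smul :: "complex \<Rightarrow> ('k \<Rightarrow>\<^sub>0 complex) \<Rightarrow> ('k \<Rightarrow>\<^sub>0 complex)" where
  "smul c p = Poly_Mapping.map ((*) c) p"

lemma lookup_smul [simp]: "Poly_Mapping.lookup (smul c p) w = c * Poly_Mapping.lookup p w"
  unfolding smul_def by transfer (simp add: when_def)

interpretation pm: vector_space smul
  by standard (auto intro!: poly_mapping_eqI simp: lookup_add algebra_simps)

definition lin :: "('k \<Rightarrow> complex) \<Rightarrow> ('k \<Rightarrow>\<^sub>0 complex) \<Rightarrow> complex" where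
  "lin F p = (\<Sum>w\<in>Poly_Mapping.keys p. Poly_Mapping.lookup p w * F w)"

lemma lin_superset:
  assumes "finite S" "Poly_Mapping.keys p \<subseteq> S"
  shows "lin F p = (\<Sum>w\<in>S. Poly_Mapping.lookup p w * F w)"
  unfolding lin_def using assms by (intro sum.mono_neutral_left) (auto simp: in_keys_iff)

lemma lin_zero [simp]: "lin F 0 = 0" by (simp add: lin_def)

lemma lin_single [simp]: "lin F (Poly_Mapping.single w c) = c * F w"
  by (simp add: lin_def)

lemma lin_add: "lin F (p + q) = lin F p + lin F q"
proof -
  let ?S = "Poly_Mapping.keys p \<union> Poly_Mapping.keys q"
  have "Poly_Mapping.keys (p + q) \<subseteq> ?S" by (rule keys_add)
  then show ?thesis
    by (simp add: lin_superset[of ?S] lookup_add distrib_right sum.distrib)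
qed

lemma lin_smul: "lin F (smul c p) = c * lin F p"
proof -
  have "Poly_Mapping.keys (smul c p) \<subseteq> Poly_Mapping.keys p" by (auto simp: in_keys_iff)
  then show ?thesis
    by (simp add: lin_superset[of "Poly_Mapping.keys p"] sum_distrib_left mult.assoc)
qed

lemma lin_uminus: "lin F (- p) = - lin F p"
  using lin_add[of F p "- p"] by (simp add: eq_neg_iff_add_eq_0 add.commute)

lemma lin_diff: "lin F (p - q) = lin F p - lin F q"
  using lin_add[of F p "- q"] by (simp add: lin_uminus)

lemma lin_sum: "lin F (\<Sum>i\<in>I. f i) = (\<Sum>i\<in>I. lin F (f i))"
  by (induction I rule: infinite_finite_induct) (auto simp: lin_add)

lemma poly_mapping_expand:
  fixes p :: "'k \<Rightarrow>\<^sub>0 complex"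
  shows "p = (\<Sum>w\<in>Poly_Mapping.keys p. Poly_Mapping.single w (Poly_Mapping.lookup p w))"
  by (rule poly_mapping_eqI) (simp add: lookup_sum lookup_single when_def in_keys_iff)

text \<open>A positive semidefinite matrix is a Gram matrix: it is the matrix of a degenerate inner product in
  the standard basis, and an orthonormal system provides coordinates for the basis vectors. The
  number of coordinates is padded with zeros to the size of the index set.\<close>

lemma gram_factorisation:
  fixes M :: "'k \<Rightarrow> 'k \<Rightarrow> complex"
  assumes fin: "finite K"
    and herm: "\<And>u v. M v u = cnj (M u v)"
    and psd: "\<And>c. 0 \<le> Re (\<Sum>u\<in>K. \<Sum>v\<in>K. cnj (c u) * M u v * c v)"
  shows "\<exists>D. \<forall>u\<in>K. \<forall>v\<in>K. M u v = (\<Sum>r<card K. cnj (D r u) * D r v)"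
proof -
  define V where "V = {p :: 'k \<Rightarrow>\<^sub>0 complex. Poly_Mapping.keys p \<subseteq> K}"
  define s :: "('k \<Rightarrow>\<^sub>0 complex) \<Rightarrow> ('k \<Rightarrow>\<^sub>0 complex) \<Rightarrow> complex"
    where "s p q = lin (\<lambda>v. cnj (lin (\<lambda>u. cnj (M u v)) q)) p" for p q
  have s_eq: "s p q = (\<Sum>v\<in>A. \<Sum>u\<in>B. Poly_Mapping.lookup p v * cnj (Poly_Mapping.lookup q u) * M u v)"
    if "finite A" "finite B" "Poly_Mapping.keys p \<subseteq> A" "Poly_Mapping.keys q \<subseteq> B" for A B p q
    using that by (simp add: s_def lin_superset[of A] lin_superset[of B] sum_distrib_left mult_ac)
  interpret psd_form smul V s
  proof
    show "pm.subspace V"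
      unfolding pm.subspace_def V_def
      by (auto simp: subset_iff dest!: subsetD[OF keys_add]) (auto simp: in_keys_iff)
    show "s (x + y) z = s x z + s y z" for x y z by (simp add: s_def lin_add)
    show "s (smul c x) y = c * s x y" for c x y by (simp add: s_def lin_smul)
    show "s y x = cnj (s x y)" for x y
      by (simp add: s_eq[OF finite_keys finite_keys order_refl order_refl])
         (subst sum.swap, intro sum.cong refl, simp add: herm[symmetric] mult_ac)
    show "0 \<le> Re (s x x)" if "x \<in> V" for x
    proof -
      have "s x x = (\<Sum>u\<in>K. \<Sum>v\<in>K. cnj (Poly_Mapping.lookup x u) * M u v * Poly_Mapping.lookup x v)"
        using that fin by (subst s_eq[of K K]) (auto simp: V_def mult_ac intro: sum.swap)
      then show ?thesis using psd by simp
    qed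
  qed
  obtain us where us: "distinct us" "set us = K"
    using fin finite_distinct_list by blast
  define X where "X u = Poly_Mapping.single u (1::complex)" for u :: 'k
  have XV: "u \<in> K \<Longrightarrow> X u \<in> V" for u by (simp add: X_def V_def)
  have "set (map X us) \<subseteq> V" using us XV by auto
  then obtain m b where m: "m \<le> length (map X us)" and b: "orthonormal b m"
    and expand: "\<forall>u\<in>set (map X us). \<forall>y\<in>V. s u y = (\<Sum>i<m. s u (b i) * s (b i) y)"
    using gram_schmidt by blast
  have m': "m \<le> card K" using m us distinct_card by fastforce
  define D where "D r v = (if r < m then s (X v) (b r) else 0)" for r v
  have "M u v = (\<Sum>r<card K. cnj (D r u) * D r v)" if uv: "u \<in> K" "v \<in> K" for u v
  proof -
    have "M u v = s (X v) (X u)" by (simp add: s_def X_def)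
    also have "\<dots> = (\<Sum>i<m. s (X v) (b i) * s (b i) (X u))"
      using expand us(2) uv XV by auto
    also have "\<dots> = (\<Sum>i<m. cnj (D i u) * D i v)"
      by (intro sum.cong refl) (simp add: D_def s_hermitian[of "b _" "X u"] mult.commute)
    also have "\<dots> = (\<Sum>r<card K. cnj (D r u) * D r v)"
      using m' by (intro sum.mono_neutral_left) (auto simp: D_def)
    finally show ?thesis .
  qed
  then show ?thesis by blast
qed

lemma gram_quadratic_form:
  fixes F :: "'x \<Rightarrow> 'k \<Rightarrow> complex"
  shows "(\<Sum>i\<in>K. \<Sum>k\<in>K. cnj (c i) * (\<Sum>x\<in>I. cnj (F x i) * F x k) * c k) =
    (\<Sum>x\<in>I. complex_of_real ((cmod (\<Sum>k\<in>K. F x k * c k))\<^sup>2))"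
proof -
  have "(\<Sum>i\<in>K. \<Sum>k\<in>K. cnj (c i) * (\<Sum>x\<in>I. cnj (F x i) * F x k) * c k) =
      (\<Sum>i\<in>K. \<Sum>k\<in>K. \<Sum>x\<in>I. cnj (F x i * c i) * (F x k * c k))"
    by (simp add: sum_distrib_left sum_distrib_right mult_ac)
  also have "\<dots> = (\<Sum>i\<in>K. \<Sum>x\<in>I. \<Sum>k\<in>K. cnj (F x i * c i) * (F x k * c k))"
    by (intro sum.cong refl sum.swap)
  also have "\<dots> = (\<Sum>x\<in>I. \<Sum>i\<in>K. \<Sum>k\<in>K. cnj (F x i * c i) * (F x k * c k))"
    by (rule sum.swap)
  also have "\<dots> = (\<Sum>x\<in>I. complex_of_real ((cmod (\<Sum>k\<in>K. F x k * c k))\<^sup>2))"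
  proof (rule sum.cong[OF refl])
    fix x
    have "(\<Sum>i\<in>K. \<Sum>k\<in>K. cnj (F x i * c i) * (F x k * c k)) = cnj (\<Sum>k\<in>K. F x k * c k) * (\<Sum>k\<in>K. F x k * c k)"
      by (simp only: cnj_sum sum_product)
    also have "\<dots> = complex_of_real ((cmod (\<Sum>k\<in>K. F x k * c k))\<^sup>2)"
      by (simp only: complex_norm_square mult.commute)
    finally show "(\<Sum>i\<in>K. \<Sum>k\<in>K. cnj (F x i * c i) * (F x k * c k)) = complex_of_real ((cmod (\<Sum>k\<in>K. F x k * c k))\<^sup>2)" .
  qed
  finally show ?thesis .
qed

section \<open>The involution and evaluation\<close>

lemma mult_expand:
  fixes p q :: "'k::monoid_add \<Rightarrow>\<^sub>0 complex"
  shows "p * q = (\<Sum>u\<in>Poly_Mapping.keys p. \<Sum>v\<in>Poly_Mapping.keys q.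
      Poly_Mapping.single (u + v) (Poly_Mapping.lookup p u * Poly_Mapping.lookup q v))"
proof -
  have "p * q = (\<Sum>u\<in>Poly_Mapping.keys p. Poly_Mapping.single u (Poly_Mapping.lookup p u)) *
      (\<Sum>v\<in>Poly_Mapping.keys q. Poly_Mapping.single v (Poly_Mapping.lookup q v))"
    using poly_mapping_expand[of p] poly_mapping_expand[of q] by simp
  then show ?thesis by (simp add: sum_product mult_single)
qed

lemma lin_mult:
  "lin F (p * q) = (\<Sum>u\<in>Poly_Mapping.keys p. \<Sum>v\<in>Poly_Mapping.keys q.
     Poly_Mapping.lookup p u * Poly_Mapping.lookup q v * F (u + v))"
  by (simp add: mult_expand[of p q] lin_sum)

lemma lin_sum_fun: "lin (\<lambda>w. \<Sum>i\<in>I. F i w) p = (\<Sum>i\<in>I. lin (F i) p)"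
  by (simp add: lin_def sum_distrib_left) (rule sum.swap)

lemma lin_mult_fun: "lin (\<lambda>w. F w * z) p = lin F p * z"
  by (simp add: lin_def sum_distrib_right mult.assoc)

lemma one_eq_single_Nil: "(1 :: 'g ncpoly) = Poly_Mapping.single [] 1"
  by (simp add: zero_list_def flip: single_one)

lemma letter_star_involution [simp]: "letter_star (letter_star x) = x"
  by (cases x) auto

lemma word_star_involution [simp]: "word_star (word_star w) = w"
  by (simp add: word_star_def rev_map o_def)

lemma word_star_append: "word_star (u @ v) = word_star v @ word_star u"
  by (simp add: word_star_def)

lemma length_word_star [simp]: "length (word_star w) = length w"
  by (simp add: word_star_def)

lemma word_star_eq_iff [simp]: "word_star u = word_star v \<longleftrightarrow> u = v"
  by (metis word_star_involution)

lemma lookup_nc_star [simp]: "Poly_Mapping.lookup (nc_star p) w = cnj (Poly_Mapping.lookup p (word_star w))"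
proof -
  have "Poly_Mapping.lookup (nc_star p) w =
      (\<Sum>v\<in>Poly_Mapping.keys p. if v = word_star w then cnj (Poly_Mapping.lookup p v) else 0)"
    unfolding nc_star_def lookup_sum
    by (intro sum.cong refl) (auto simp: lookup_single when_def)
  also have "\<dots> = cnj (Poly_Mapping.lookup p (word_star w))"
    by (simp add: in_keys_iff)
  finally show ?thesis .
qed

lemma lin_nc_star: "lin F (nc_star p) = (\<Sum>w\<in>Poly_Mapping.keys p. cnj (Poly_Mapping.lookup p w) * F (word_star w))"
  by (simp add: nc_star_def lin_sum)

lemma keys_nc_star: "Poly_Mapping.keys (nc_star p) = word_star ` Poly_Mapping.keys p"
proof (rule Set.set_eqI)
  fix w
  have "w \<in> Poly_Mapping.keys (nc_star p) \<longleftrightarrow> word_star w \<in> Poly_Mapping.keys p"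
    by (simp add: in_keys_iff)
  also have "\<dots> \<longleftrightarrow> w \<in> word_star ` Poly_Mapping.keys p"
    by (auto simp: image_iff intro!: bexI[of _ "word_star w"])
  finally show "w \<in> Poly_Mapping.keys (nc_star p) \<longleftrightarrow> w \<in> word_star ` Poly_Mapping.keys p" .
qed

lemma nc_star_add: "nc_star (p + q) = nc_star p + nc_star q"
  by (rule poly_mapping_eqI) (simp add: lookup_add)

lemma nc_star_diff: "nc_star (p - q) = nc_star p - nc_star q"
  by (rule poly_mapping_eqI) (simp add: lookup_minus)

lemma nc_star_zero [simp]: "nc_star 0 = 0"
  by (rule poly_mapping_eqI) simp

lemma nc_star_sum: "nc_star (\<Sum>i\<in>I. f i) = (\<Sum>i\<in>I. nc_star (f i))"
  by (induction I rule: infinite_finite_induct) (auto simp: nc_star_add)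

lemma nc_star_involution [simp]: "nc_star (nc_star p) = p"
  by (rule poly_mapping_eqI) simp

lemma nc_star_smul: "nc_star (smul c p) = smul (cnj c) (nc_star p)"
  by (rule poly_mapping_eqI) simp

lemma nc_star_single: "nc_star (Poly_Mapping.single w c) = Poly_Mapping.single (word_star w) (cnj c)"
  by (cases "c = 0") (auto simp: nc_star_def)

lemma poly_mapping_eq_lin: "(\<And>F. lin F p = lin F q) \<Longrightarrow> p = q"
proof (rule poly_mapping_eqI)
  fix k assume *: "\<And>F. lin F p = lin F q"
  have "lin (\<lambda>w. if w = k then 1 else 0) r = Poly_Mapping.lookup r k" for r :: "'a \<Rightarrow>\<^sub>0 complex"
    by (simp add: lin_def in_keys_iff if_distrib cong: if_cong)
  then show "Poly_Mapping.lookup p k = Poly_Mapping.lookup q k" using * by metis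
qed

lemma sum_image_word_star: "(\<Sum>w\<in>word_star ` S. f w) = (\<Sum>w\<in>S. f (word_star w))"
  by (subst sum.reindex) (auto simp: inj_on_def)

lemma nc_star_mult: "nc_star (p * q) = nc_star q * nc_star p"
proof (rule poly_mapping_eq_lin)
  fix F :: "'a letter list \<Rightarrow> complex"
  have "lin F (nc_star (p * q)) = (\<Sum>u\<in>Poly_Mapping.keys p. \<Sum>v\<in>Poly_Mapping.keys q.
      cnj (Poly_Mapping.lookup p u) * cnj (Poly_Mapping.lookup q v) * F (word_star v + word_star u))"
    by (simp add: mult_expand[of p q] nc_star_sum lin_sum nc_star_single plus_list_def word_star_append)
  also have "\<dots> = lin F (nc_star q * nc_star p)"
    by (subst sum.swap) (simp add: lin_mult keys_nc_star sum_image_word_star mult_ac)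
  finally show "lin F (nc_star (p * q)) = lin F (nc_star q * nc_star p)" .
qed

lemma smul_mult_left: "smul c p * q = smul c (p * q)"
  for p q :: "'k::monoid_add \<Rightarrow>\<^sub>0 complex"
  by (simp add: smul_def mult_map_scale_conv_mult mult.assoc)

lemma smul_mult_right: "p * smul c q = smul c (p * q)"
  for p q :: "'k::monoid_add \<Rightarrow>\<^sub>0 complex"
proof -
  have "p * Poly_Mapping.single 0 c = Poly_Mapping.single 0 c * p"
    by (rule poly_mapping_eq_lin) (simp add: lin_mult mult_ac)
  then show ?thesis
    by (simp add: smul_def mult_map_scale_conv_mult) (simp flip: mult.assoc)
qed

lemma nc_degree_le_iff: "nc_degree p \<le> d \<longleftrightarrow> (\<forall>w\<in>Poly_Mapping.keys p. length w \<le> d)"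
  by (auto simp: nc_degree_def)

lemma conjugate_complex_cnj [simp]: "conjugate (z::complex) = cnj z"
  by (simp add: conjugate_complex_def)

lemma mat_adjoint_carrier [simp]: "A \<in> carrier_mat n n \<Longrightarrow> mat_adjoint A \<in> carrier_mat n n"
  by (auto simp: mat_adjoint_def)

lemma mat_adjoint_index [simp]:
  "A \<in> carrier_mat n n \<Longrightarrow> i < n \<Longrightarrow> j < n \<Longrightarrow> mat_adjoint A $$ (i, j) = cnj (A $$ (j, i) :: complex)"
  by (auto simp: mat_adjoint_def mat_of_rows_index)

lemma mat_adjoint_mult:
  fixes A B :: "complex mat"
  assumes "A \<in> carrier_mat n n" "B \<in> carrier_mat n n"
  shows "mat_adjoint (A * B) = mat_adjoint B * mat_adjoint A"
proof (rule eq_matI)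
  have AB: "A * B \<in> carrier_mat n n" "mat_adjoint A \<in> carrier_mat n n" "mat_adjoint B \<in> carrier_mat n n"
    using assms by auto
  fix i j assume "i < dim_row (mat_adjoint B * mat_adjoint A)" "j < dim_col (mat_adjoint B * mat_adjoint A)"
  then have ij: "i < n" "j < n" using AB by auto
  show "mat_adjoint (A * B) $$ (i, j) = (mat_adjoint B * mat_adjoint A) $$ (i, j)"
    using ij AB assms
    by (simp add: mat_adjoint_index[OF mult_carrier_mat[OF assms]] mat_adjoint_index[OF assms(1)]
        mat_adjoint_index[OF assms(2)] carrier_matD[OF AB(2)] carrier_matD[OF AB(3)] scalar_prod_def mult.commute)
qed (use assms in \<open>auto simp: mat_adjoint_def\<close>)

lemma mat_adjoint_involution: "A \<in> carrier_mat n n \<Longrightarrow> mat_adjoint (mat_adjoint A) = (A :: complex mat)"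
  by (rule eq_matI) (auto simp: mat_adjoint_def mat_of_rows_index)

lemma mat_adjoint_one: "mat_adjoint (1\<^sub>m n) = (1\<^sub>m n :: complex mat)"
  by (rule eq_matI) (auto simp: mat_adjoint_def mat_of_rows_index)

lemma mat_adjoint_inner:
  fixes A :: "complex mat"
  assumes "A \<in> carrier_mat n n" "v \<in> carrier_vec n" "w \<in> carrier_vec n"
  shows "(mat_adjoint A *\<^sub>v v) \<bullet>c w = v \<bullet>c (A *\<^sub>v w)"
proof -
  have "(mat_adjoint A *\<^sub>v v) \<bullet>c w = (\<Sum>i<n. \<Sum>k<n. cnj (A $$ (k, i)) * v $ k * cnj (w $ i))"
    using assms by (simp add: scalar_prod_def lessThan_atLeast0 sum_distrib_right mat_adjoint_index[OF assms(1)] carrier_matD[OF mat_adjoint_carrier[OF assms(1)]])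
  also have "\<dots> = (\<Sum>k<n. \<Sum>i<n. cnj (A $$ (k, i)) * v $ k * cnj (w $ i))"
    by (rule sum.swap)
  also have "\<dots> = v \<bullet>c (A *\<^sub>v w)"
    using assms by (simp add: scalar_prod_def lessThan_atLeast0 sum_distrib_left mult_ac)
  finally show ?thesis .
qed

lemma word_eval_Nil: "word_eval n A [] = 1\<^sub>m n"
  by (simp add: word_eval_def)

lemma word_eval_Cons: "word_eval n A (x # w) = letter_eval A x * word_eval n A w"
  by (simp add: word_eval_def)

context
  fixes n :: nat and A :: "'g \<Rightarrow> complex mat"
  assumes A_carrier: "\<And>j. A j \<in> carrier_mat n n"
begin

lemma letter_eval_carrier: "letter_eval A x \<in> carrier_mat n n"
  using A_carrier by (cases x) auto

lemma word_eval_carrier: "word_eval n A w \<in> carrier_mat n n"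
  by (induction w) (auto simp: word_eval_Nil word_eval_Cons intro: mult_carrier_mat[OF letter_eval_carrier])

lemma word_eval_append: "word_eval n A (u @ v) = word_eval n A u * word_eval n A v"
  by (induction u)
     (auto simp: word_eval_Nil word_eval_Cons left_mult_one_mat[OF word_eval_carrier]
        assoc_mult_mat[OF letter_eval_carrier word_eval_carrier word_eval_carrier])

lemma letter_eval_star: "letter_eval A (letter_star x) = mat_adjoint (letter_eval A x)"
  using A_carrier by (cases x) (auto simp: mat_adjoint_involution[OF A_carrier])

lemma word_eval_star: "word_eval n A (word_star w) = mat_adjoint (word_eval n A w)"
proof (induction w)
  case Nil
  show ?case by (simp add: word_star_def word_eval_Nil mat_adjoint_one)
next
  case (Cons x w)
  have "word_eval n A (word_star (x # w)) = word_eval n A (word_star w) * word_eval n A [letter_star x]"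
    by (simp add: word_star_def word_eval_append)
  also have "word_eval n A [letter_star x] = mat_adjoint (letter_eval A x)"
    by (simp add: word_eval_Cons word_eval_Nil letter_eval_star
        right_mult_one_mat[OF mat_adjoint_carrier[OF letter_eval_carrier]])
  finally show ?case
    by (simp add: Cons.IH word_eval_Cons mat_adjoint_mult[OF letter_eval_carrier word_eval_carrier])
qed

lemma nc_eval_carrier: "nc_eval n A p \<in> carrier_mat n n"
  by (simp add: nc_eval_def mat_sum_def)

lemma nc_eval_index: "r < n \<Longrightarrow> c < n \<Longrightarrow> nc_eval n A p $$ (r, c) = lin (\<lambda>w. word_eval n A w $$ (r, c)) p"
  using word_eval_carrier by (simp add: nc_eval_def mat_sum_def lin_def carrier_matD[OF word_eval_carrier])

lemma nc_eval_vec_index: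
  assumes "i < n" "x \<in> carrier_vec n"
  shows "(nc_eval n A p *\<^sub>v x) $ i = lin (\<lambda>w. (word_eval n A w *\<^sub>v x) $ i) p"
  using assms
  by (simp add: carrier_matD[OF nc_eval_carrier] carrier_matD[OF word_eval_carrier]
      scalar_prod_def nc_eval_index lin_sum_fun lin_mult_fun)

lemma nc_eval_inner:
  assumes "x \<in> carrier_vec n" "y \<in> carrier_vec n"
  shows "(nc_eval n A p *\<^sub>v x) \<bullet>c y = lin (\<lambda>w. (word_eval n A w *\<^sub>v x) \<bullet>c y) p"
proof -
  have "(nc_eval n A p *\<^sub>v x) \<bullet>c y = (\<Sum>i<n. (nc_eval n A p *\<^sub>v x) $ i * cnj (y $ i))"
    using assms by (simp add: scalar_prod_def lessThan_atLeast0)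
  also have "\<dots> = (\<Sum>i<n. lin (\<lambda>w. (word_eval n A w *\<^sub>v x) $ i) p * cnj (y $ i))"
    using assms by (intro sum.cong refl) (simp only: nc_eval_vec_index lessThan_iff)
  also have "\<dots> = lin (\<lambda>w. (word_eval n A w *\<^sub>v x) \<bullet>c y) p"
    using assms by (simp only: lin_sum_fun[symmetric] lin_mult_fun[symmetric])
       (simp add: scalar_prod_def lessThan_atLeast0)
  finally show ?thesis .
qed

lemma nc_eval_add: "nc_eval n A (p + q) = nc_eval n A p + nc_eval n A q"
  by (rule eq_matI)
     (auto simp: nc_eval_index lin_add carrier_matD[OF nc_eval_carrier])

lemma nc_eval_mult: "nc_eval n A (p * q) = nc_eval n A p * nc_eval n A q"
proof (rule eq_matI)
  fix r c assume "r < dim_row (nc_eval n A p * nc_eval n A q)" "c < dim_col (nc_eval n A p * nc_eval n A q)"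
  then have rc: "r < n" "c < n" by (auto simp: carrier_matD[OF nc_eval_carrier])
  have "nc_eval n A (p * q) $$ (r, c) = (\<Sum>u\<in>Poly_Mapping.keys p. \<Sum>v\<in>Poly_Mapping.keys q. \<Sum>k<n.
      (Poly_Mapping.lookup p u * word_eval n A u $$ (r, k)) * (Poly_Mapping.lookup q v * word_eval n A v $$ (k, c)))"
    using rc by (simp add: nc_eval_index lin_mult plus_list_def word_eval_append scalar_prod_def
        carrier_matD[OF word_eval_carrier] lessThan_atLeast0 sum_distrib_left mult_ac)
  also have "\<dots> = (\<Sum>k<n. \<Sum>u\<in>Poly_Mapping.keys p. \<Sum>v\<in>Poly_Mapping.keys q.
      (Poly_Mapping.lookup p u * word_eval n A u $$ (r, k)) * (Poly_Mapping.lookup q v * word_eval n A v $$ (k, c)))"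
    by (subst (2) sum.swap, subst (1) sum.swap) (rule refl)
  also have "\<dots> = (nc_eval n A p * nc_eval n A q) $$ (r, c)"
    using rc by (simp add: carrier_matD[OF nc_eval_carrier] scalar_prod_def nc_eval_index
        lin_def sum_product lessThan_atLeast0)
  finally show "nc_eval n A (p * q) $$ (r, c) = (nc_eval n A p * nc_eval n A q) $$ (r, c)" .
qed (auto simp: carrier_matD[OF nc_eval_carrier])

text \<open>The vector state of \<open>x\<close> sends \<open>p\<^sup>* p\<close> to the squared length of \<open>p(A) x\<close>.\<close>

lemma eval_square:
  assumes x: "x \<in> carrier_vec n"
  shows "lin (\<lambda>w. (word_eval n A w *\<^sub>v x) \<bullet>c x) (nc_star p * p) =
    complex_of_real (\<Sum>i<n. (cmod (lin (\<lambda>w. (word_eval n A w *\<^sub>v x) $ i) p))\<^sup>2)"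
proof -
  have inner: "(word_eval n A (word_star u + v) *\<^sub>v x) \<bullet>c x =
      (\<Sum>i<n. (word_eval n A v *\<^sub>v x) $ i * cnj ((word_eval n A u *\<^sub>v x) $ i))" for u v
  proof -
    have "(word_eval n A (word_star u + v) *\<^sub>v x) \<bullet>c x = (word_eval n A v *\<^sub>v x) \<bullet>c (word_eval n A u *\<^sub>v x)"
      unfolding plus_list_def word_eval_append word_eval_star
      by (subst assoc_mult_mat_vec[OF mat_adjoint_carrier[OF word_eval_carrier] word_eval_carrier x],
          rule mat_adjoint_inner[OF word_eval_carrier mult_mat_vec_carrier[OF word_eval_carrier x] x])
    also have "\<dots> = (\<Sum>i<n. (word_eval n A v *\<^sub>v x) $ i * cnj ((word_eval n A u *\<^sub>v x) $ i))"
      using mult_mat_vec_carrier[OF word_eval_carrier x, of u]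
      by (simp add: scalar_prod_def lessThan_atLeast0 carrier_matD[OF word_eval_carrier] del: index_mult_mat_vec)
    finally show ?thesis .
  qed
  have "lin (\<lambda>w. (word_eval n A w *\<^sub>v x) \<bullet>c x) (nc_star p * p) =
      (\<Sum>u\<in>Poly_Mapping.keys p. \<Sum>v\<in>Poly_Mapping.keys p. \<Sum>i<n.
        cnj (Poly_Mapping.lookup p u) * Poly_Mapping.lookup p v *
          ((word_eval n A v *\<^sub>v x) $ i * cnj ((word_eval n A u *\<^sub>v x) $ i)))"
    by (simp only: lin_mult keys_nc_star sum_image_word_star lookup_nc_star word_star_involution inner sum_distrib_left)
  also have "\<dots> = (\<Sum>i<n. \<Sum>u\<in>Poly_Mapping.keys p. \<Sum>v\<in>Poly_Mapping.keys p.
        cnj (Poly_Mapping.lookup p u) * Poly_Mapping.lookup p v *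
          ((word_eval n A v *\<^sub>v x) $ i * cnj ((word_eval n A u *\<^sub>v x) $ i)))"
    by (subst (2) sum.swap, subst (1) sum.swap) (rule refl)
  also have "\<dots> = (\<Sum>i<n. lin (\<lambda>w. (word_eval n A w *\<^sub>v x) $ i) p * cnj (lin (\<lambda>w. (word_eval n A w *\<^sub>v x) $ i) p))"
    by (intro sum.cong refl, subst sum.swap) (simp add: lin_def sum_product cnj_sum mult_ac)
  also have "\<dots> = complex_of_real (\<Sum>i<n. (cmod (lin (\<lambda>w. (word_eval n A w *\<^sub>v x) $ i) p))\<^sup>2)"
    by (simp only: complex_norm_square of_real_sum)
  finally show ?thesis .
qed

end

lemma nc_eval_star:
  assumes A: "\<And>j. A j \<in> carrier_mat n n"
  shows "nc_eval n A (nc_star p) = mat_adjoint (nc_eval n A p)"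
proof (rule eq_matI)
  note carr = nc_eval_carrier[of A n, OF A]
  fix r c assume "r < dim_row (mat_adjoint (nc_eval n A p))" "c < dim_col (mat_adjoint (nc_eval n A p))"
  then have rc: "r < n" "c < n" by (auto simp: carrier_matD[OF mat_adjoint_carrier[OF carr]])
  show "nc_eval n A (nc_star p) $$ (r, c) = mat_adjoint (nc_eval n A p) $$ (r, c)"
    unfolding nc_eval_index[OF A rc] lin_nc_star mat_adjoint_index[OF carr rc] nc_eval_index[OF A rc(2,1)]
    using rc by (simp add: word_eval_star[OF A] mat_adjoint_index[OF word_eval_carrier[OF A]] lin_def)
qed (auto simp: carrier_matD[OF nc_eval_carrier[of A n, OF A]] carrier_matD[OF mat_adjoint_carrier[OF nc_eval_carrier[of A n, OF A]]])

section \<open>The spherical ideal\<close>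

lemma spherical_isometryD:
  assumes "spherical_isometry n A"
  shows "A j \<in> carrier_mat n n"
    and "r < n \<Longrightarrow> c < n \<Longrightarrow> (\<Sum>j\<in>UNIV. (mat_adjoint (A j) * A j) $$ (r, c)) = (if r = c then 1 else 0)"
proof -
  show "A j \<in> carrier_mat n n" using assms by (simp add: spherical_isometry_def)
  assume rc: "r < n" "c < n"
  have "mat_sum n (\<lambda>j. mat_adjoint (A j) * A j) UNIV $$ (r, c) = 1\<^sub>m n $$ (r, c)"
    using assms by (simp add: spherical_isometry_def)
  then show "(\<Sum>j\<in>UNIV. (mat_adjoint (A j) * A j) $$ (r, c)) = (if r = c then 1 else 0)"
    using rc by (simp add: mat_sum_def)
qed

lemma spherical_ideal_two_sided: "two_sided_ideal spherical_ideal"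
  unfolding spherical_ideal_def by (rule hull_in) (auto simp: two_sided_ideal_def)

lemma spherical_ideal_zero [simp]: "0 \<in> spherical_ideal"
  and spherical_ideal_add: "x \<in> spherical_ideal \<Longrightarrow> y \<in> spherical_ideal \<Longrightarrow> x + y \<in> spherical_ideal"
  and spherical_ideal_mult_left: "x \<in> spherical_ideal \<Longrightarrow> a * x \<in> spherical_ideal"
  and spherical_ideal_mult_right: "x \<in> spherical_ideal \<Longrightarrow> x * a \<in> spherical_ideal"
  using spherical_ideal_two_sided by (auto simp: two_sided_ideal_def)

lemma spherical_ideal_uminus: "x \<in> spherical_ideal \<Longrightarrow> - x \<in> spherical_ideal"
  using spherical_ideal_mult_left[of x "-1"] by simp

lemma spherical_ideal_diff: "x \<in> spherical_ideal \<Longrightarrow> y \<in> spherical_ideal \<Longrightarrow> x - y \<in> spherical_ideal"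
  using spherical_ideal_add[of x "- y"] spherical_ideal_uminus[of y] by simp

lemma spherical_ideal_smul: "x \<in> spherical_ideal \<Longrightarrow> smul c x \<in> spherical_ideal"
  by (simp add: smul_def mult_map_scale_conv_mult spherical_ideal_mult_left)

lemma spherical_ideal_sum: "(\<And>i. i \<in> S \<Longrightarrow> f i \<in> spherical_ideal) \<Longrightarrow> (\<Sum>i\<in>S. f i) \<in> spherical_ideal"
  by (induction S rule: infinite_finite_induct) (auto simp: spherical_ideal_add)

lemma spherical_relation_in_ideal: "spherical_relation \<in> spherical_ideal"
  unfolding spherical_ideal_def by (rule hull_inc) simp

lemma spherical_relation_words:
  "spherical_relation = Poly_Mapping.single [] 1 - (\<Sum>j\<in>UNIV. Poly_Mapping.single [XT j, X j] (1::complex))"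
  by (simp add: spherical_relation_def nc_gen_def mult_single plus_list_def one_eq_single_Nil)

lemma nc_star_spherical_relation: "nc_star spherical_relation = spherical_relation"
  by (simp add: spherical_relation_words nc_star_diff nc_star_sum nc_star_single word_star_def)

lemma nc_star_in_ideal:
  assumes "q \<in> spherical_ideal" shows "nc_star q \<in> spherical_ideal"
proof -
  have "two_sided_ideal {q. nc_star q \<in> (spherical_ideal :: 'a ncpoly set)}"
    by (auto simp: two_sided_ideal_def nc_star_add nc_star_mult
        intro: spherical_ideal_add spherical_ideal_mult_left spherical_ideal_mult_right)
  then have "two_sided_ideal hull {spherical_relation} \<subseteq> {q. nc_star q \<in> (spherical_ideal :: 'a ncpoly set)}"
    by (intro hull_minimal) (simp_all add: nc_star_spherical_relation spherical_relation_in_ideal)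
  then show ?thesis using assms unfolding spherical_ideal_def[symmetric] by blast
qed

lemma nc_eval_spherical_ideal:
  assumes A: "spherical_isometry n A" and q: "q \<in> spherical_ideal"
  shows "nc_eval n A q = 0\<^sub>m n n"
proof -
  have carr: "\<And>j. A j \<in> carrier_mat n n" using spherical_isometryD(1)[OF A] .
  note carrs = nc_eval_carrier[of A n, OF carr]
  have rel: "nc_eval n A spherical_relation = 0\<^sub>m n n"
  proof (rule eq_matI)
    fix r c assume "r < dim_row (0\<^sub>m n n :: complex mat)" "c < dim_col (0\<^sub>m n n :: complex mat)"
    then have rc: "r < n" "c < n" by auto
    have "word_eval n A [XT j, X j] = mat_adjoint (A j) * A j" for j
      using carr[of j] by (simp add: word_eval_def right_mult_one_mat)
    then show "nc_eval n A spherical_relation $$ (r, c) = 0\<^sub>m n n $$ (r, c)"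
      using rc spherical_isometryD(2)[OF A rc]
      by (simp add: nc_eval_index[OF carr] spherical_relation_words lin_diff lin_sum word_eval_Nil)
  qed (auto simp: carrier_matD[OF carrs])
  have "two_sided_ideal {q. nc_eval n A q = 0\<^sub>m n n}"
    unfolding two_sided_ideal_def
  proof (intro conjI ballI allI)
    show "0 \<in> {q. nc_eval n A q = 0\<^sub>m n n}"
      by (auto intro!: eq_matI simp: nc_eval_index[OF carr] carrier_matD[OF carrs])
  qed (auto simp: nc_eval_add[OF carr] nc_eval_mult[OF carr] left_mult_zero_mat[OF carrs] right_mult_zero_mat[OF carrs])
  then have "spherical_ideal \<subseteq> {q. nc_eval n A q = 0\<^sub>m n n}"
    unfolding spherical_ideal_def using rel by (intro hull_minimal) auto
  then show ?thesis using q by blast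
qed

lemma lin_spherical_ideal:
  assumes A: "spherical_isometry n A" and q: "q \<in> spherical_ideal" and x: "x \<in> carrier_vec n"
  shows "i < n \<Longrightarrow> lin (\<lambda>w. (word_eval n A w *\<^sub>v x) $ i) q = 0"
    and "lin (\<lambda>w. (word_eval n A w *\<^sub>v x) \<bullet>c x) q = 0"
proof -
  have carr: "\<And>j. A j \<in> carrier_mat n n" using spherical_isometryD(1)[OF A] .
  have z: "nc_eval n A q *\<^sub>v x = 0\<^sub>v n"
    using x by (auto simp: nc_eval_spherical_ideal[OF A q])
  show "i < n \<Longrightarrow> lin (\<lambda>w. (word_eval n A w *\<^sub>v x) $ i) q = 0"
    using nc_eval_vec_index[where A = A and p = q, OF carr _ x, of i] z by simp
  show "lin (\<lambda>w. (word_eval n A w *\<^sub>v x) \<bullet>c x) q = 0"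
    using nc_eval_inner[where A = A and p = q, OF carr x x] z x by simp
qed

section \<open>Dilating a contractive tuple to a spherical isometry\<close>

definition block_vec :: "nat \<Rightarrow> nat \<Rightarrow> (nat \<Rightarrow> complex) \<Rightarrow> (nat \<Rightarrow> complex) \<Rightarrow> complex vec" where
  "block_vec m M h k = vec (m + M) (\<lambda>i. if i < m then h i else k (i - m))"

lemma block_vec_carrier [simp]: "block_vec m M h k \<in> carrier_vec (m + M)"
  by (simp add: block_vec_def)

lemma block_vec_index [simp]: "i < m + M \<Longrightarrow> block_vec m M h k $ i = (if i < m then h i else k (i - m))"
  by (simp add: block_vec_def)

lemma block_vec_cong:
  "(\<And>i. i < m \<Longrightarrow> h i = h' i) \<Longrightarrow> (\<And>r. r < M \<Longrightarrow> k r = k' r) \<Longrightarrow> block_vec m M h k = block_vec m M h' k'"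
  by (auto simp: block_vec_def intro!: eq_vecI)

text \<open>In block form, on \<open>(h, k)\<close> with \<open>h\<close> in dimension \<open>m\<close> and \<open>k\<close> in dimension \<open>M\<close>:
  \<open>A\<^sub>j\<^sub>1 (h, k) = (a\<^sub>j\<^sub>1 h, D h)\<close>, \<open>A\<^sub>j\<^sub>2 (h, k) = (a\<^sub>j\<^sub>2 h, k)\<close>, and
  \<open>A\<^sub>j (h, k) = (a\<^sub>j h, 0)\<close> for the other indices. The defect \<open>D\<close> makes the column
  isometric on the first block. The second block is sent to itself by a different matrix
  of the tuple than the one that contains \<open>D\<close>, so that its image is orthogonal to the image of
  \<open>D\<close>. As \<open>D\<close> has \<open>m\<close> rows, \<open>D h\<close> is padded with zeros to dimension \<open>M\<close>.\<close>

definition dilation ::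
  "nat \<Rightarrow> nat \<Rightarrow> 'g \<Rightarrow> 'g \<Rightarrow> ('g \<Rightarrow> nat \<Rightarrow> nat \<Rightarrow> complex) \<Rightarrow> (nat \<Rightarrow> nat \<Rightarrow> complex) \<Rightarrow> 'g \<Rightarrow> complex mat" where
  "dilation m M j1 j2 a D j = mat (m + M) (m + M) (\<lambda>(r, c).
     if c < m then (if r < m then a j r c else if j = j1 \<and> r - m < m then D (r - m) c else 0)
     else if j = j2 \<and> r = c then 1 else 0)"

lemma dilation_carrier [simp]: "dilation m M j1 j2 a D j \<in> carrier_mat (m + M) (m + M)"
  by (simp add: dilation_def)

lemma sum_lessThan_add: "(\<Sum>i<m + M. f i) = (\<Sum>i<m. f i) + (\<Sum>r<M. f (m + r))"
  for m M :: nat and f :: "nat \<Rightarrow> 'a::comm_monoid_add"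
  by (induction M) (auto simp: add.assoc)

lemma sum_lessThan_mask:
  fixes f :: "nat \<Rightarrow> 'a::comm_monoid_add"
  assumes "m \<le> M"
  shows "(\<Sum>r<M. if r < m then f r else 0) = (\<Sum>r<m. f r)"
  using assms by (intro sum.mono_neutral_cong_right) auto

lemma dilation_block_vec:
  "dilation m M j1 j2 a D j *\<^sub>v block_vec m M h k =
     block_vec m M (\<lambda>i. \<Sum>c<m. a j i c * h c)
       (\<lambda>r. (if j = j1 \<and> r < m then \<Sum>c<m. D r c * h c else 0) + (if j = j2 then k r else 0))"
proof (rule eq_vecI)
  fix i assume "i < dim_vec (block_vec m M (\<lambda>i. \<Sum>c<m. a j i c * h c)
       (\<lambda>r. (if j = j1 \<and> r < m then \<Sum>c<m. D r c * h c else 0) + (if j = j2 then k r else 0)))"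
  then have i: "i < m + M" by (simp add: block_vec_def)
  have "(dilation m M j1 j2 a D j *\<^sub>v block_vec m M h k) $ i =
      (\<Sum>c<m + M. dilation m M j1 j2 a D j $$ (i, c) * block_vec m M h k $ c)"
    using i carrier_matD[OF dilation_carrier[of m M j1 j2 a D j]]
    by (simp add: scalar_prod_def lessThan_atLeast0 carrier_vecD[OF block_vec_carrier])
  also have "\<dots> = (\<Sum>c<m. (if i < m then a j i c else if j = j1 \<and> i - m < m then D (i - m) c else 0) * h c)
      + (\<Sum>r<M. (if j = j2 \<and> i = m + r then 1 else 0) * k r)"
    using i unfolding sum_lessThan_add
    by (intro arg_cong2[where f = "(+)"] sum.cong) (auto simp: dilation_def)
  also have "(\<Sum>r<M. (if j = j2 \<and> i = m + r then 1 else 0) * k r) =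
      (\<Sum>r<M. if r = i - m then (if j = j2 \<and> i \<ge> m then k r else 0) else 0)"
    by (intro sum.cong) auto
  also have "\<dots> = (if j = j2 \<and> i \<ge> m then k (i - m) else 0)"
    using i by auto
  finally show "(dilation m M j1 j2 a D j *\<^sub>v block_vec m M h k) $ i =
      block_vec m M (\<lambda>i. \<Sum>c<m. a j i c * h c)
       (\<lambda>r. (if j = j1 \<and> r < m then \<Sum>c<m. D r c * h c else 0) + (if j = j2 then k r else 0)) $ i"
    using i by auto
qed (simp add: dilation_def block_vec_def)

lemma adjoint_dilation_block_vec:
  assumes "m \<le> M"
  shows "mat_adjoint (dilation m M j1 j2 a D j) *\<^sub>v block_vec m M h k =
     block_vec m M (\<lambda>i. (\<Sum>c<m. cnj (a j c i) * h c) + (if j = j1 then \<Sum>r<m. cnj (D r i) * k r else 0))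
       (\<lambda>r. if j = j2 then k r else 0)" (is "?L = ?R")
proof (rule eq_vecI)
  fix i assume "i < dim_vec ?R"
  then have i: "i < m + M" by (simp add: block_vec_def)
  have "?L $ i = (\<Sum>c<m + M. cnj (dilation m M j1 j2 a D j $$ (c, i)) * block_vec m M h k $ c)"
    using i carrier_matD[OF mat_adjoint_carrier[OF dilation_carrier[of m M j1 j2 a D j]]]
    by (simp add: scalar_prod_def lessThan_atLeast0 carrier_vecD[OF block_vec_carrier]
        mat_adjoint_index[OF dilation_carrier])
  also have "\<dots> = ?R $ i"
  proof (cases "i < m")
    case True
    have "(\<Sum>c<m + M. cnj (dilation m M j1 j2 a D j $$ (c, i)) * block_vec m M h k $ c) =
        (\<Sum>c<m. cnj (a j c i) * h c) + (\<Sum>r<M. if r < m then if j = j1 then cnj (D r i) * k r else 0 else 0)"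
      unfolding sum_lessThan_add using True
      by (intro arg_cong2[where f = "(+)"] sum.cong refl) (auto simp: dilation_def)
    then show ?thesis using i True by (auto simp: sum_lessThan_mask[OF assms])
  next
    case False
    then obtain s where s: "i = m + s" "s < M" using i by (metis add_less_cancel_left le_Suc_ex not_less)
    have "(\<Sum>c<m + M. cnj (dilation m M j1 j2 a D j $$ (c, i)) * block_vec m M h k $ c) =
        (\<Sum>c<m. 0) + (\<Sum>r<M. if r = s then if j = j2 then k r else 0 else 0)"
      unfolding sum_lessThan_add using s
      by (intro arg_cong2[where f = "(+)"] sum.cong refl) (auto simp: dilation_def)
    then show ?thesis using s by simp
  qed
  finally show "?L $ i = ?R $ i" .
qed (simp add: block_vec_def mat_adjoint_def dilation_def)

text \<open>A factor of the defect operator \<open>1 - \<Sum>\<^sub>j a\<^sub>j\<^sup>* a\<^sub>j\<close> of the tuple; its positive square root is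
  one choice.\<close>

definition defect_factor :: "nat \<Rightarrow> ('g::finite \<Rightarrow> nat \<Rightarrow> nat \<Rightarrow> complex) \<Rightarrow> (nat \<Rightarrow> nat \<Rightarrow> complex) \<Rightarrow> bool" where
  "defect_factor m a D \<longleftrightarrow> (\<forall>i<m. \<forall>k<m. (\<Sum>r<m. cnj (D r i) * D r k) =
     (if i = k then 1 else 0) - (\<Sum>j\<in>UNIV. \<Sum>r<m. cnj (a j r i) * a j r k))"

lemma spherical_isometry_dilation:
  fixes a :: "'g::finite \<Rightarrow> nat \<Rightarrow> nat \<Rightarrow> complex"
  assumes mM: "m \<le> M" and j12: "j1 \<noteq> j2" and D: "defect_factor m a D"
  shows "spherical_isometry (m + M) (dilation m M j1 j2 a D)"
  unfolding spherical_isometry_def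
proof (intro conjI allI)
  show "dilation m M j1 j2 a D j \<in> carrier_mat (m + M) (m + M)" for j by simp
  let ?A = "dilation m M j1 j2 a D"
  show "mat_sum (m + M) (\<lambda>j. mat_adjoint (?A j) * ?A j) UNIV = 1\<^sub>m (m + M)"
  proof (rule eq_matI)
    fix i k assume "i < dim_row (1\<^sub>m (m + M) :: complex mat)" "k < dim_col (1\<^sub>m (m + M) :: complex mat)"
    then have ik: "i < m + M" "k < m + M" by auto
    have entry: "(mat_adjoint (?A j) * ?A j) $$ (i, k) =
        (\<Sum>r<m. cnj (?A j $$ (r, i)) * ?A j $$ (r, k)) + (\<Sum>r<M. cnj (?A j $$ (m + r, i)) * ?A j $$ (m + r, k))" for j
    proof -
      have "(mat_adjoint (?A j) * ?A j) $$ (i, k) = (\<Sum>r<m + M. cnj (?A j $$ (r, i)) * ?A j $$ (r, k))"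
        using ik carrier_matD[OF mat_adjoint_carrier[OF dilation_carrier[of m M j1 j2 a D j]]]
          carrier_matD[OF dilation_carrier[of m M j1 j2 a D j]]
        by (simp add: scalar_prod_def lessThan_atLeast0 mat_adjoint_index[OF dilation_carrier])
      then show ?thesis by (simp add: sum_lessThan_add)
    qed
    have top: "(\<Sum>r<m. cnj (?A j $$ (r, i)) * ?A j $$ (r, k)) =
        (if i < m \<and> k < m then \<Sum>r<m. cnj (a j r i) * a j r k else 0)" for j
      using ik by (auto simp: dilation_def intro!: sum.neutral)
    have bottom: "(\<Sum>r<M. cnj (?A j $$ (m + r, i)) * ?A j $$ (m + r, k)) =
        (if i < m \<and> k < m then if j = j1 then \<Sum>r<m. cnj (D r i) * D r k else 0
         else if j = j2 \<and> i = k then 1 else 0)" for j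
    proof (cases "i < m \<and> k < m")
      case True
      then have "(\<Sum>r<M. cnj (?A j $$ (m + r, i)) * ?A j $$ (m + r, k)) =
          (\<Sum>r<M. if r < m then (if j = j1 then cnj (D r i) * D r k else 0) else 0)"
        by (intro sum.cong) (auto simp: dilation_def)
      then show ?thesis using True mM by (simp add: sum_lessThan_mask)
    next
      case False
      then have "(\<Sum>r<M. cnj (?A j $$ (m + r, i)) * ?A j $$ (m + r, k)) =
          (\<Sum>r<M. if r = i - m then (if j = j2 \<and> i = k then 1 else 0) else 0)"
        using ik j12 by (intro sum.cong) (auto simp: dilation_def)
      then show ?thesis using False ik by auto
    qed
    have "(\<Sum>j\<in>UNIV. (mat_adjoint (?A j) * ?A j) $$ (i, k)) = (if i = k then 1 else 0)"
    proof (cases "i < m \<and> k < m")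
      case True
      then show ?thesis using D unfolding defect_factor_def
        by (simp only: entry top bottom) (simp add: sum.distrib)
    next
      case False
      then have "(\<Sum>j\<in>UNIV. (mat_adjoint (?A j) * ?A j) $$ (i, k)) =
          (\<Sum>j\<in>UNIV. if j = j2 then (if i = k then 1 else 0) else 0)"
        by (intro sum.cong refl) (simp only: entry top bottom, auto)
      then show ?thesis by simp
    qed
    then show "mat_sum (m + M) (\<lambda>j. mat_adjoint (?A j) * ?A j) UNIV $$ (i, k) = 1\<^sub>m (m + M) $$ (i, k)"
      using ik by (simp add: mat_sum_def)
  qed (auto simp: mat_sum_def)
qed

lemma defect_quadratic_form:
  fixes a :: "'g::finite \<Rightarrow> nat \<Rightarrow> nat \<Rightarrow> complex"
  shows "(\<Sum>i<m. \<Sum>k<m. cnj (c i) * ((if i = k then 1 else 0) - (\<Sum>j\<in>UNIV. \<Sum>r<m. cnj (a j r i) * a j r k)) * c k) =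
    complex_of_real ((\<Sum>k<m. (cmod (c k))\<^sup>2) - (\<Sum>j\<in>UNIV. \<Sum>r<m. (cmod (\<Sum>k<m. a j r k * c k))\<^sup>2))"
proof -
  have diag: "(\<Sum>i<m. \<Sum>k<m. cnj (c i) * (if i = k then 1 else 0) * c k) = (\<Sum>k<m. complex_of_real ((cmod (c k))\<^sup>2))"
  proof (intro sum.cong refl)
    fix i assume "i \<in> {..<m}"
    have "(\<Sum>k<m. cnj (c i) * (if i = k then 1 else 0) * c k) = (\<Sum>k<m. if k = i then cnj (c i) * c i else 0)"
      by (intro sum.cong) auto
    also have "\<dots> = cnj (c i) * c i" using \<open>i \<in> {..<m}\<close> by simp
    finally show "(\<Sum>k<m. cnj (c i) * (if i = k then 1 else 0) * c k) = complex_of_real ((cmod (c i))\<^sup>2)"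
      by (simp only: complex_norm_square mult.commute)
  qed
  have off: "(\<Sum>i<m. \<Sum>k<m. cnj (c i) * (\<Sum>j\<in>UNIV. \<Sum>r<m. cnj (a j r i) * a j r k) * c k) =
      (\<Sum>j\<in>UNIV. \<Sum>r<m. complex_of_real ((cmod (\<Sum>k<m. a j r k * c k))\<^sup>2))"
    using gram_quadratic_form[where F = "\<lambda>(j, r). a j r" and I = "UNIV \<times> {..<m}" and K = "{..<m}" and c = c]
    by (simp add: sum.cartesian_product')
  show ?thesis
    unfolding right_diff_distrib left_diff_distrib sum_subtractf diag off by simp
qed

lemma defect_factor_exists:
  fixes a :: "'g::finite \<Rightarrow> nat \<Rightarrow> nat \<Rightarrow> complex"
  assumes contr: "\<And>h. (\<Sum>j\<in>UNIV. \<Sum>r<m. (cmod (\<Sum>k<m. a j r k * h k))\<^sup>2) \<le> (\<Sum>k<m. (cmod (h k))\<^sup>2)"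
  shows "\<exists>D. defect_factor m a D"
proof -
  define G where "G i k = (if i = k then 1 else 0) - (\<Sum>j\<in>UNIV. \<Sum>r<m. cnj (a j r i) * a j r k)" for i k
  have "\<exists>D. \<forall>i\<in>{..<m}. \<forall>k\<in>{..<m}. G i k = (\<Sum>r<card {..<m}. cnj (D r i) * D r k)"
  proof (rule gram_factorisation)
    show "G k i = cnj (G i k)" for i k
      by (simp add: G_def mult.commute)
    show "0 \<le> Re (\<Sum>i<m. \<Sum>k<m. cnj (c i) * G i k * c k)" for c
      unfolding G_def defect_quadratic_form using contr[of c] by simp
  qed simp
  then obtain D where "\<And>i k. i < m \<Longrightarrow> k < m \<Longrightarrow> G i k = (\<Sum>r<m. cnj (D r i) * D r k)"
    by auto
  then have "defect_factor m a D" by (simp add: defect_factor_def G_def)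
  then show ?thesis by blast
qed

lemma defect_factor_norm:
  fixes a :: "'g::finite \<Rightarrow> nat \<Rightarrow> nat \<Rightarrow> complex"
  assumes "defect_factor m a D"
  shows "(\<Sum>r<m. (cmod (\<Sum>k<m. D r k * c k))\<^sup>2) =
    (\<Sum>k<m. (cmod (c k))\<^sup>2) - (\<Sum>j\<in>UNIV. \<Sum>r<m. (cmod (\<Sum>k<m. a j r k * c k))\<^sup>2)"
proof -
  have "complex_of_real (\<Sum>r<m. (cmod (\<Sum>k<m. D r k * c k))\<^sup>2) =
      (\<Sum>i<m. \<Sum>k<m. cnj (c i) * (\<Sum>r<m. cnj (D r i) * D r k) * c k)"
    unfolding gram_quadratic_form of_real_sum ..
  also have "\<dots> = (\<Sum>i<m. \<Sum>k<m. cnj (c i) * ((if i = k then 1 else 0) - (\<Sum>j\<in>UNIV. \<Sum>r<m. cnj (a j r i) * a j r k)) * c k)"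
    using assms by (intro sum.cong refl) (simp add: defect_factor_def)
  finally show ?thesis
    unfolding defect_quadratic_form by (simp only: of_real_eq_iff)
qed

section \<open>Representations that detect a single normal word\<close>

definition normal_word :: "'g \<Rightarrow> 'g letter list \<Rightarrow> bool" where
  "normal_word i w \<longleftrightarrow> (\<forall>u v. w \<noteq> u @ [XT i, X i] @ v)"

lemma normal_word_ConsD: "normal_word i (x # w) \<Longrightarrow> normal_word i w"
  unfolding normal_word_def by (metis append_Cons)

lemma normal_word_XT_hd: "normal_word i (XT i # w) \<Longrightarrow> w = [] \<or> hd w \<noteq> X i"
  unfolding normal_word_def by (metis append_Cons append_Nil list.exhaust_sel)

text \<open>With \<open>l = length z\<close>, the letters act on \<open>\<complex>\<^sup>l\<^sup>+\<^sup>1\<close> by steps along a path: the letter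
  \<open>z ! r\<close> contributes half of \<open>e\<^sub>r\<close> to the image of \<open>e\<^sub>r\<^sub>+\<^sub>1\<close>, and its adjoint letter goes
  back. Starting from \<open>e\<^sub>l\<close>, the word \<open>z\<close> is then the only one of length at most \<open>l\<close> that
  produces a component along \<open>e\<^sub>0\<close>. The factor one half makes the tuple contractive.\<close>

definition path_entry :: "'g letter list \<Rightarrow> 'g letter \<Rightarrow> nat \<Rightarrow> nat \<Rightarrow> complex" where
  "path_entry z x r c = (if c = Suc r \<and> z ! r = x then 1/2 else 0)
     + (if r = Suc c \<and> z ! c = letter_star x then 1/2 else 0)"

lemma path_entry_star: "path_entry z (letter_star x) r c = cnj (path_entry z x c r)"
  by (simp add: path_entry_def)

lemma path_entry_band: "c \<noteq> Suc r \<Longrightarrow> r \<noteq> Suc c \<Longrightarrow> path_entry z x r c = 0"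
  by (simp add: path_entry_def)

text \<open>Every coordinate of \<open>h\<close> is used at most twice, once for each neighbour on the path, and
  \<open>\<bar>x / 2 + y / 2\<bar>\<^sup>2 \<le> (\<bar>x\<bar>\<^sup>2 + \<bar>y\<bar>\<^sup>2) / 2\<close>.\<close>

lemma path_contraction:
  fixes z :: "'g::finite letter list"
  shows "(\<Sum>j\<in>UNIV. \<Sum>r<Suc (length z). (cmod (\<Sum>k<Suc (length z). path_entry z (X j) r k * h k))\<^sup>2)
           \<le> (\<Sum>k<Suc (length z). (cmod (h k))\<^sup>2)"
proof -
  define l where "l = length z"
  define up where "up j r = (if r < l \<and> z ! r = X j then h (Suc r) else 0)" for j r
  define dn where "dn j r = (if 0 < r \<and> z ! (r - 1) = XT j then h (r - 1) else 0)" for j r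
  have row: "(\<Sum>k<Suc l. path_entry z (X j) r k * h k) = up j r / 2 + dn j r / 2" if r: "r < Suc l" for j r
  proof -
    have "(\<Sum>k<Suc l. path_entry z (X j) r k * h k) =
        (\<Sum>k<Suc l. if k = Suc r then (if z ! r = X j then h (Suc r) / 2 else 0) else 0) +
        (\<Sum>k<Suc l. if k = r - 1 then (if 0 < r \<and> z ! (r - 1) = XT j then h (r - 1) / 2 else 0) else 0)"
      unfolding sum.distrib[symmetric] by (intro sum.cong refl) (auto simp: path_entry_def)
    also have "\<dots> = up j r / 2 + dn j r / 2"
      using r by (auto simp: up_def dn_def)
    finally show ?thesis .
  qed
  have half: "(cmod (x / 2 + y / 2))\<^sup>2 \<le> ((cmod x)\<^sup>2 + (cmod y)\<^sup>2) / 2" for x y :: complex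
  proof -
    have "cmod (x / 2 + y / 2) \<le> (cmod x + cmod y) / 2"
      using norm_triangle_ineq[of "x / 2" "y / 2"] by (simp add: norm_divide)
    then have "(cmod (x / 2 + y / 2))\<^sup>2 \<le> ((cmod x + cmod y) / 2)\<^sup>2"
      by (intro power_mono) auto
    also have "\<dots> \<le> ((cmod x)\<^sup>2 + (cmod y)\<^sup>2) / 2"
      using zero_le_power2[of "cmod x - cmod y"] by (simp add: power2_eq_square field_simps)
    finally show ?thesis .
  qed
  have up_sum: "(\<Sum>j\<in>UNIV. (cmod (up j r))\<^sup>2) \<le> (if r < l then (cmod (h (Suc r)))\<^sup>2 else 0)" for r
  proof (cases "z ! r")
    case (X i)
    then have "(\<Sum>j\<in>UNIV. (cmod (up j r))\<^sup>2) = (\<Sum>j\<in>UNIV. if j = i then (if r < l then (cmod (h (Suc r)))\<^sup>2 else 0) else 0)"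
      by (intro sum.cong) (auto simp: up_def)
    then show ?thesis by simp
  qed (auto simp: up_def)
  have dn_sum: "(\<Sum>j\<in>UNIV. (cmod (dn j r))\<^sup>2) \<le> (if 0 < r then (cmod (h (r - 1)))\<^sup>2 else 0)" for r
  proof (cases "z ! (r - 1)")
    case (XT i)
    then have "(\<Sum>j\<in>UNIV. (cmod (dn j r))\<^sup>2) = (\<Sum>j\<in>UNIV. if j = i then (if 0 < r then (cmod (h (r - 1)))\<^sup>2 else 0) else 0)"
      by (intro sum.cong) (auto simp: dn_def)
    then show ?thesis by simp
  qed (auto simp: dn_def)
  have "(\<Sum>j\<in>UNIV. \<Sum>r<Suc l. (cmod (\<Sum>k<Suc l. path_entry z (X j) r k * h k))\<^sup>2)
      \<le> (\<Sum>j\<in>UNIV. \<Sum>r<Suc l. ((cmod (up j r))\<^sup>2 + (cmod (dn j r))\<^sup>2) / 2)"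
  proof (intro sum_mono)
    fix j :: 'g and r assume "r \<in> {..<Suc l}"
    then show "(cmod (\<Sum>k<Suc l. path_entry z (X j) r k * h k))\<^sup>2 \<le> ((cmod (up j r))\<^sup>2 + (cmod (dn j r))\<^sup>2) / 2"
      using row[of r j] half[of "up j r" "dn j r"] by simp
  qed
  also have "\<dots> = (\<Sum>r<Suc l. ((\<Sum>j\<in>UNIV. (cmod (up j r))\<^sup>2) + (\<Sum>j\<in>UNIV. (cmod (dn j r))\<^sup>2)) / 2)"
    by (subst sum.swap) (simp add: sum.distrib add_divide_distrib sum_divide_distrib)
  also have "\<dots> \<le> (\<Sum>r<Suc l. ((if r < l then (cmod (h (Suc r)))\<^sup>2 else 0) + (if 0 < r then (cmod (h (r - 1)))\<^sup>2 else 0)) / 2)"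
    by (intro sum_mono divide_right_mono add_mono up_sum dn_sum) auto
  also have "\<dots> = ((\<Sum>r<Suc l. if r < l then (cmod (h (Suc r)))\<^sup>2 else 0) + (\<Sum>r<Suc l. if 0 < r then (cmod (h (r - 1)))\<^sup>2 else 0)) / 2"
    by (simp only: sum_divide_distrib[symmetric] sum.distrib)
  also have "(\<Sum>r<Suc l. if r < l then (cmod (h (Suc r)))\<^sup>2 else 0) = (\<Sum>r<l. (cmod (h (Suc r)))\<^sup>2)"
    by simp
  also have "\<dots> \<le> (\<Sum>k<Suc l. (cmod (h k))\<^sup>2)"
    by (subst sum.lessThan_Suc_shift) simp
  also have "(\<Sum>r<Suc l. if 0 < r then (cmod (h (r - 1)))\<^sup>2 else 0) = (\<Sum>k<l. (cmod (h k))\<^sup>2)"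
    by (subst sum.lessThan_Suc_shift) simp
  also have "\<dots> \<le> (\<Sum>k<Suc l. (cmod (h k))\<^sup>2)" by simp
  finally show ?thesis by (simp add: l_def)
qed

text \<open>After dilation a normal word still moves the starting vector by at most one step per letter. The only
  new way to return from the added block is through \<open>D\<^sup>*\<close>, applied by the letter \<open>XT j1\<close>, to a vector
  \<open>D g\<close> that was created by an earlier letter \<open>X j1\<close>. Then \<open>D\<^sup>* D = 1 - \<Sum>\<^sub>j a\<^sub>j\<^sup>* a\<^sub>j\<close> moves
  \<open>g\<close> by at most two steps, and in a normal word some letter lies between the two, so that
  at least three letters pay for these two steps. This is why the support of \<open>g\<close> has to be
  tracked with one step to spare right after \<open>X j1\<close> and two steps to spare later. The leading
  coefficient of \<open>h\<close> is therefore produced by steps along the path alone.\<close>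

lemma path_dilation_orbit:
  fixes z w :: "'g::finite letter list"
  defines "m \<equiv> Suc (length z)" and "a \<equiv> (\<lambda>j. path_entry z (X j))"
  assumes j12: "j1 \<noteq> j2" and mM: "m \<le> M" and D: "defect_factor m a D"
    and w: "normal_word j1 w" "length w \<le> length z"
  shows "\<exists>h g. word_eval (m + M) (dilation m M j1 j2 a D) w *\<^sub>v
               block_vec m M (\<lambda>i. if i = length z then 1 else 0) (\<lambda>_. 0) =
             block_vec m M h (\<lambda>r. if r < m then \<Sum>c<m. D r c * g c else 0)
           \<and> (\<forall>i<m. i + length w < length z \<longrightarrow> h i = 0)
           \<and> (\<forall>i<m. i + length w < length z + 1 \<longrightarrow> g i = 0)
           \<and> (w = [] \<or> hd w \<noteq> X j1 \<longrightarrow> (\<forall>i<m. i + length w < length z + 2 \<longrightarrow> g i = 0))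
           \<and> h (length z - length w) = (if w = drop (length z - length w) z then (1/2) ^ length w else 0)"
  using w
proof (induction w)
  case Nil
  let ?e = "\<lambda>i. if i = length z then 1 else 0 :: complex"
  have "word_eval (m + M) (dilation m M j1 j2 a D) [] *\<^sub>v block_vec m M ?e (\<lambda>_. 0) = block_vec m M ?e (\<lambda>_. 0)"
    by (simp add: word_eval_def one_mult_mat_vec[OF block_vec_carrier])
  moreover have "block_vec m M ?e (\<lambda>_. 0) =
      block_vec m M ?e (\<lambda>r. if r < m then \<Sum>c<m. D r c * (\<lambda>_. 0) c else 0)"
    by (intro block_vec_cong) auto
  ultimately show ?case
    by (intro exI[of _ ?e] exI[of _ "\<lambda>_. 0"]) auto
next
  case (Cons x w)
  let ?A = "dilation m M j1 j2 a D" and ?l = "length z" and ?n = "length w"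
  let ?\<xi> = "block_vec m M (\<lambda>i. if i = ?l then 1 else 0) (\<lambda>_. 0)"
  have n: "Suc ?n \<le> ?l" using Cons.prems by simp
  have "normal_word j1 w" "length w \<le> ?l"
    using Cons.prems normal_word_ConsD by auto
  from Cons.IH[OF this] obtain h g where hg: "word_eval (m + M) ?A w *\<^sub>v ?\<xi> =
        block_vec m M h (\<lambda>r. if r < m then \<Sum>c<m. D r c * g c else 0)"
    and h0': "\<forall>i<m. i + ?n < ?l \<longrightarrow> h i = 0"
    and g1': "\<forall>i<m. i + ?n < ?l + 1 \<longrightarrow> g i = 0"
    and g2': "w = [] \<or> hd w \<noteq> X j1 \<longrightarrow> (\<forall>i<m. i + ?n < ?l + 2 \<longrightarrow> g i = 0)"
    and lead: "h (?l - ?n) = (if w = drop (?l - ?n) z then (1/2) ^ ?n else 0)"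
    by (elim exE conjE)
  note h0 = h0'[rule_format] and g1 = g1'[rule_format] and g2 = g2'[rule_format]
  have carr: "\<And>j. ?A j \<in> carrier_mat (m + M) (m + M)" by simp
  have step: "word_eval (m + M) ?A (x # w) *\<^sub>v ?\<xi> =
      letter_eval ?A x *\<^sub>v block_vec m M h (\<lambda>r. if r < m then \<Sum>c<m. D r c * g c else 0)"
    unfolding word_eval_Cons hg[symmetric]
    by (rule assoc_mult_mat_vec[OF letter_eval_carrier[OF carr] word_eval_carrier[OF carr] block_vec_carrier])
  define base where "base i = (\<Sum>c<m. path_entry z x i c * h c)" for i
  have base0: "base i = 0" if "i < m" "i + Suc ?n < ?l" for i
    unfolding base_def
  proof (rule sum.neutral, intro ballI)
    fix c assume "c \<in> {..<m}"
    then show "path_entry z x i c * h c = 0"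
      using h0[of c] that by (cases "c \<le> Suc i") (auto simp: path_entry_band)
  qed
  have base_lead: "base q = (if x # w = drop q z then (1/2) ^ Suc ?n else 0)" if q: "Suc q = ?l - ?n" for q
  proof -
    have "base q = (\<Sum>c<m. if c = Suc q then path_entry z x q (Suc q) * h (Suc q) else 0)"
      unfolding base_def
    proof (rule sum.cong[OF refl])
      fix c assume "c \<in> {..<m}"
      then show "path_entry z x q c * h c = (if c = Suc q then path_entry z x q (Suc q) * h (Suc q) else 0)"
        using h0[of c] n q by (cases "c < Suc q") (auto simp: path_entry_band)
    qed
    also have "\<dots> = path_entry z x q (Suc q) * h (Suc q)"
    proof -
      have "Suc q < m" unfolding m_def using q by linarith
      then show ?thesis by simp
    qed
    also have "path_entry z x q (Suc q) = (if z ! q = x then 1/2 else 0)"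
      by (simp add: path_entry_def)
    also have "h (Suc q) = (if w = drop (Suc q) z then (1/2) ^ ?n else 0)"
      using lead by (simp only: q)
    finally have val: "base q = (if z ! q = x then 1/2 else 0) * (if w = drop (Suc q) z then (1/2) ^ ?n else 0)" .
    have "q < ?l" using q by linarith
    then have decomp: "drop q z = z ! q # drop (Suc q) z" by (rule Cons_nth_drop_Suc[symmetric])
    have "x # w = drop q z \<longleftrightarrow> z ! q = x \<and> w = drop (Suc q) z"
      unfolding decomp list.inject by (rule conj_cong[OF eq_commute refl])
    then show ?thesis unfolding val by (cases "z ! q = x"; cases "w = drop (Suc q) z") simp_all
  qed
  \<comment> \<open>\<open>base\<close> is the contribution of the path operators to the new first block, \<open>corr\<close> that of the return through \<open>D\<^sup>*\<close>.\<close>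
  define corr where "corr i = (if x = XT j1 then \<Sum>r<m. cnj (D r i) * (\<Sum>c<m. D r c * g c) else 0)" for i
  have corr0: "corr i = 0" if i: "i < m" "i + ?n < ?l" for i
  proof (cases "x = XT j1")
    case True
    have hd_w: "w = [] \<or> hd w \<noteq> X j1"
      using Cons.prems(1) unfolding True by (rule normal_word_XT_hd)
    have DD: "(\<Sum>r<m. cnj (D r i) * D r c) * g c = 0" if c: "c < m" for c
    proof (cases "c \<le> i + 2")
      case True
      then show ?thesis using g2[OF hd_w, of c] c i by simp
    next
      case False
      have "cnj (a j r i) * a j r c = 0" for j r
        using False unfolding a_def
        by (cases "i \<noteq> Suc r \<and> r \<noteq> Suc i") (auto simp: path_entry_band)
      then show ?thesis using D c i False by (simp add: defect_factor_def)
    qed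
    have "corr i = (\<Sum>c<m. (\<Sum>r<m. cnj (D r i) * D r c) * g c)"
      unfolding corr_def using True
      by (simp add: sum_distrib_left sum_distrib_right mult.assoc) (rule sum.swap)
    then show ?thesis using DD by simp
  qed (simp add: corr_def)
  \<comment> \<open>The new second block is again an image under \<open>D\<close>: of \<open>h\<close> after \<open>X j1\<close>, of \<open>g\<close> when \<open>j2\<close> acts, and of zero otherwise.\<close>
  define g' where "g' = (if x = X j1 then h else if x = X j2 \<or> x = XT j2 then g else (\<lambda>_. 0))"
  have eval: "word_eval (m + M) ?A (x # w) *\<^sub>v ?\<xi> =
      block_vec m M (\<lambda>i. base i + corr i) (\<lambda>r. if r < m then \<Sum>c<m. D r c * g' c else 0)"
  proof (cases x)
    case (X j)
    then show ?thesis
      unfolding step using j12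
      by (simp add: dilation_block_vec)
         (intro block_vec_cong, auto simp: base_def corr_def g'_def a_def)
  next
    case (XT j)
    then show ?thesis
      unfolding step using j12
      by (simp add: adjoint_dilation_block_vec[OF mM])
         (intro block_vec_cong, auto simp: base_def corr_def g'_def a_def path_entry_star[of z "X j", simplified])
  qed
  show ?case
  proof (intro exI conjI, rule eval)
    show "\<forall>i<m. i + length (x # w) < ?l \<longrightarrow> base i + corr i = 0"
      using base0 corr0 by auto
    show "\<forall>i<m. i + length (x # w) < ?l + 1 \<longrightarrow> g' i = 0"
      using h0 g1 by (auto simp: g'_def)
    show "x # w = [] \<or> hd (x # w) \<noteq> X j1 \<longrightarrow> (\<forall>i<m. i + length (x # w) < ?l + 2 \<longrightarrow> g' i = 0)"
      using g1 by (auto simp: g'_def)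
    show "base (?l - length (x # w)) + corr (?l - length (x # w)) =
        (if x # w = drop (?l - length (x # w)) z then (1/2) ^ length (x # w) else 0)"
    proof -
      have "Suc (?l - Suc ?n) = ?l - ?n" "?l - Suc ?n < m" "?l - Suc ?n + ?n < ?l"
        unfolding m_def using n by linarith+
      then show ?thesis using base_lead corr0 by simp
    qed
  qed
qed

lemma path_representation:
  fixes z :: "'g::finite letter list"
  assumes j12: "j1 \<noteq> j2" and N: "2 * (length z + 1) \<le> N"
  obtains A \<xi> where "spherical_isometry N A" "\<xi> \<in> carrier_vec N"
    "\<And>w. normal_word j1 w \<Longrightarrow> length w \<le> length z \<Longrightarrow>
       (word_eval N A w *\<^sub>v \<xi>) $ 0 = (if w = z then (1/2) ^ length z else 0)"
proof -
  define m where "m = Suc (length z)"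
  define M where "M = N - m"
  have mM: "m \<le> M" and N_eq: "N = m + M" using N by (auto simp: m_def M_def)
  define a where "a = (\<lambda>j. path_entry z (X j))"
  obtain D where D: "defect_factor m a D"
    using defect_factor_exists[where m = m and a = a] path_contraction[of z] unfolding m_def a_def by blast
  let ?A = "dilation m M j1 j2 a D"
  let ?\<xi> = "block_vec m M (\<lambda>i. if i = length z then 1 else 0) (\<lambda>_. 0)"
  have "(word_eval N ?A w *\<^sub>v ?\<xi>) $ 0 = (if w = z then (1/2) ^ length z else 0)"
    if w: "normal_word j1 w" "length w \<le> length z" for w
  proof -
    obtain h g where eval: "word_eval N ?A w *\<^sub>v ?\<xi> = block_vec m M h g"
      and h0: "\<forall>i<m. i + length w < length z \<longrightarrow> h i = 0"
      and lead: "h (length z - length w) = (if w = drop (length z - length w) z then (1/2) ^ length w else 0)"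
      using path_dilation_orbit[OF j12 _ _ w, folded m_def a_def, OF mM D] unfolding N_eq by blast
    have "(word_eval N ?A w *\<^sub>v ?\<xi>) $ 0 = h 0"
      unfolding eval by (subst block_vec_index) (auto simp: m_def)
    also have "h 0 = (if w = z then (1/2) ^ length z else 0)"
    proof (cases "length w = length z")
      case True
      then show ?thesis using lead by simp
    next
      case False
      then show ?thesis using h0 w(2) by (auto simp: m_def)
    qed
    finally show ?thesis .
  qed
  moreover have "spherical_isometry N ?A"
    unfolding N_eq by (rule spherical_isometry_dilation[OF mM j12 D])
  moreover have "?\<xi> \<in> carrier_vec N" by (simp add: N_eq)
  ultimately show ?thesis using that by blast
qed

section \<open>Normal forms modulo the spherical ideal\<close>

lemma UNIV_letter: "(UNIV :: 'g letter set) = range X \<union> range XT"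
  by (auto simp: image_iff) (metis letter.exhaust)

instance letter :: (finite) finite
  by standard (simp add: UNIV_letter)

definition normal_polys :: "'g \<Rightarrow> nat \<Rightarrow> 'g ncpoly set" where
  "normal_polys i d = {p. \<forall>w. Poly_Mapping.lookup p w \<noteq> 0 \<longrightarrow> normal_word i w \<and> length w \<le> d}"

definition normal_words :: "'g \<Rightarrow> nat \<Rightarrow> 'g letter list set" where
  "normal_words i d = {w. normal_word i w \<and> length w \<le> d}"

lemma finite_words_le: "finite {w :: 'g::finite letter list. length w \<le> d}"
  using finite_lists_length_le[of "UNIV :: 'g letter set" d] by simp

lemma finite_normal_words [simp]: "finite (normal_words i d)" for i :: "'g::finite"
  unfolding normal_words_def by (rule finite_subset[OF _ finite_words_le[of d]]) auto

lemma normal_polys_keys: "p \<in> normal_polys i d \<longleftrightarrow> Poly_Mapping.keys p \<subseteq> normal_words i d"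
  by (auto simp: normal_polys_def normal_words_def in_keys_iff)

lemma subspace_normal_polys: "pm.subspace (normal_polys i d)"
proof (rule pm.subspaceI)
  show "0 \<in> normal_polys i d" by (simp add: normal_polys_def)
  show "p + q \<in> normal_polys i d" if "p \<in> normal_polys i d" "q \<in> normal_polys i d" for p q
    using that keys_add[of p q] unfolding normal_polys_keys by blast
  show "smul c p \<in> normal_polys i d" if "p \<in> normal_polys i d" for c p
    using that by (simp add: normal_polys_def)
qed

lemmas normal_polys_add = pm.subspace_add[OF subspace_normal_polys]
  and normal_polys_diff = pm.subspace_diff[OF subspace_normal_polys]
  and normal_polys_smul = pm.subspace_scale[OF subspace_normal_polys]
  and normal_polys_sum = pm.subspace_sum[OF subspace_normal_polys]

lemma normal_polys_mono: "d \<le> e \<Longrightarrow> normal_polys i d \<subseteq> normal_polys i e"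
  unfolding normal_polys_def by (auto dest: order_trans)

lemma smul_single: "smul c (Poly_Mapping.single w a) = Poly_Mapping.single w (c * a)"
  by (rule poly_mapping_eqI) (simp add: lookup_single when_def)

text \<open>Replace \<open>x\<^sub>i\<^sup>T x\<^sub>i\<close> by \<open>1 - \<Sum>\<^sub>j\<^sub>\<noteq>\<^sub>i x\<^sub>j\<^sup>T x\<^sub>j\<close>. Each of the resulting words has one
  letter \<open>X i\<close> less, so the process ends.\<close>

lemma word_reduction:
  fixes w :: "'g::finite letter list"
  shows "\<exists>p \<in> normal_polys i (length w). Poly_Mapping.single w 1 - p \<in> spherical_ideal"
proof (induction "length (filter (\<lambda>x. x = X i) w)" arbitrary: w rule: less_induct)
  case less
  show ?case
  proof (cases "normal_word i w")
    case True
    then have "Poly_Mapping.single w 1 \<in> normal_polys i (length w)"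
      by (auto simp: normal_polys_def lookup_single when_def)
    then show ?thesis by (intro bexI[of _ "Poly_Mapping.single w 1"]) auto
  next
    case False
    then obtain u v where w: "w = u @ [XT i, X i] @ v"
      unfolding normal_word_def by blast
    let ?w = "\<lambda>j. u @ [XT j, X j] @ v"
    have "\<exists>p \<in> normal_polys i (length (u @ v)). Poly_Mapping.single (u @ v) 1 - p \<in> spherical_ideal"
      by (rule less) (simp add: w)
    then obtain p0 where p0: "p0 \<in> normal_polys i (length w)" "Poly_Mapping.single (u @ v) 1 - p0 \<in> spherical_ideal"
      using normal_polys_mono[of "length (u @ v)" "length w" i] by (auto simp: w)
    have "\<exists>p \<in> normal_polys i (length w). Poly_Mapping.single (?w j) 1 - p \<in> spherical_ideal" if "j \<noteq> i" for j
      using less[of "?w j"] that by (simp add: w)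
    then obtain p where p: "\<And>j. j \<noteq> i \<Longrightarrow> p j \<in> normal_polys i (length w)"
        "\<And>j. j \<noteq> i \<Longrightarrow> Poly_Mapping.single (?w j) 1 - p j \<in> spherical_ideal"
      by metis
    let ?q = "p0 - (\<Sum>j\<in>UNIV - {i}. p j)"
    have "?q \<in> normal_polys i (length w)"
      using p0 p by (intro normal_polys_diff normal_polys_sum) auto
    moreover have "Poly_Mapping.single w 1 - ?q \<in> spherical_ideal"
    proof -
      have rel: "Poly_Mapping.single u 1 * spherical_relation * Poly_Mapping.single v 1 =
          Poly_Mapping.single (u @ v) 1 - (\<Sum>j\<in>UNIV. Poly_Mapping.single (?w j) (1::complex))"
        by (simp add: spherical_relation_words algebra_simps sum_distrib_left sum_distrib_right
            mult_single plus_list_def)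
      have "Poly_Mapping.single w 1 - ?q =
          (Poly_Mapping.single (u @ v) 1 - p0) - (\<Sum>j\<in>UNIV - {i}. Poly_Mapping.single (?w j) 1 - p j)
          - Poly_Mapping.single u 1 * spherical_relation * Poly_Mapping.single v 1"
        unfolding rel by (simp add: sum.remove[of UNIV i] sum_subtractf w)
      also have "\<dots> \<in> spherical_ideal"
        by (rule spherical_ideal_diff[OF spherical_ideal_diff[OF p0(2) spherical_ideal_sum]
              spherical_ideal_mult_right[OF spherical_ideal_mult_left[OF spherical_relation_in_ideal]]])
           (rule p(2), simp)
      finally show ?thesis .
    qed
    ultimately show ?thesis by blast
  qed
qed

lemma poly_reduction:
  fixes p :: "'g::finite ncpoly"
  assumes "nc_degree p \<le> d"
  shows "\<exists>q \<in> normal_polys i d. p - q \<in> spherical_ideal"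
proof -
  obtain r where r: "\<And>w. r w \<in> normal_polys i (length w)"
      "\<And>w. Poly_Mapping.single w 1 - r w \<in> (spherical_ideal :: 'g ncpoly set)"
    using word_reduction by metis
  let ?q = "\<Sum>w\<in>Poly_Mapping.keys p. smul (Poly_Mapping.lookup p w) (r w)"
  have "r w \<in> normal_polys i d" if "w \<in> Poly_Mapping.keys p" for w
    using r(1)[of w] normal_polys_mono[of "length w" d i] that assms
    by (auto simp: nc_degree_le_iff)
  then have "?q \<in> normal_polys i d"
    by (intro normal_polys_sum normal_polys_smul)
  moreover have "p - ?q = (\<Sum>w\<in>Poly_Mapping.keys p. smul (Poly_Mapping.lookup p w) (Poly_Mapping.single w 1 - r w))"
    using poly_mapping_expand[of p]
    by (simp add: pm.scale_right_diff_distrib sum_subtractf smul_single)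
  then have "p - ?q \<in> spherical_ideal"
    using r(2) by (auto intro!: spherical_ideal_sum spherical_ideal_smul)
  ultimately show ?thesis by blast
qed

text \<open>The index \<open>i\<close> determines the normal words, and the dilation puts its defect into the matrix
  \<open>A\<^sub>i\<close>; the index \<open>j\<close> is the one whose matrix acts on the added block.\<close>

locale two_indices =
  fixes i j :: "'g::finite"
  assumes distinct_indices: "i \<noteq> j"
begin

text \<open>The representation attached to a longest word of \<open>p\<close> sees the coefficient of that word only.\<close>

lemma normal_poly_detected:
  assumes p: "p \<in> normal_polys i d" and N: "2 * (d + 1) \<le> N"
    and zero: "\<And>A \<xi>. spherical_isometry N A \<Longrightarrow> \<xi> \<in> carrier_vec N \<Longrightarrow>
      lin (\<lambda>w. (word_eval N A w *\<^sub>v \<xi>) $ 0) p = 0"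
  shows "p = 0"
proof (rule ccontr)
  assume "p \<noteq> 0"
  then have "Max (length ` Poly_Mapping.keys p) \<in> length ` Poly_Mapping.keys p"
    by (intro Max_in) auto
  then obtain z where z: "z \<in> Poly_Mapping.keys p" and "length z = Max (length ` Poly_Mapping.keys p)"
    by auto
  then have max: "\<And>w. w \<in> Poly_Mapping.keys p \<Longrightarrow> length w \<le> length z"
    by simp
  have normal: "\<And>w. w \<in> Poly_Mapping.keys p \<Longrightarrow> normal_word i w \<and> length w \<le> d"
    using p by (auto simp: normal_polys_keys normal_words_def)
  have "2 * (length z + 1) \<le> N" using normal[OF z] N by simp
  from path_representation[OF distinct_indices this] obtain A \<xi>
    where A: "spherical_isometry N A" "\<xi> \<in> carrier_vec N"
      and F: "\<And>w. normal_word i w \<Longrightarrow> length w \<le> length z \<Longrightarrow>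
       (word_eval N A w *\<^sub>v \<xi>) $ 0 = (if w = z then (1/2) ^ length z else 0)" by metis
  have "lin (\<lambda>w. (word_eval N A w *\<^sub>v \<xi>) $ 0) p =
      (\<Sum>w\<in>Poly_Mapping.keys p. if w = z then Poly_Mapping.lookup p z * (1/2) ^ length z else 0)"
    unfolding lin_def using F normal max by (intro sum.cong refl) simp
  also have "\<dots> = Poly_Mapping.lookup p z * (1/2) ^ length z" using z by simp
  also have "\<dots> \<noteq> 0" using z by (simp add: in_keys_iff)
  finally show False using zero[OF A] by simp
qed

text \<open>Elements of the ideal vanish on spherical isometries, and a nonzero polynomial in normal form
  does not. This makes normal forms unique.\<close>

lemma normal_poly_in_ideal:
  assumes "p \<in> normal_polys i d" "p \<in> spherical_ideal"
  shows "p = 0"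
  using normal_poly_detected[OF assms(1) order_refl]
  by (metis lin_spherical_ideal(1) assms(2) add_gr_0 less_one mult_pos_pos zero_less_numeral)

definition nf :: "'g ncpoly \<Rightarrow> 'g ncpoly" where
  "nf p = (THE q. (\<exists>d. q \<in> normal_polys i d) \<and> p - q \<in> spherical_ideal)"

lemma nf_eqI:
  assumes "q \<in> normal_polys i d" "p - q \<in> spherical_ideal"
  shows "nf p = q"
  unfolding nf_def
proof (rule the_equality)
  show "(\<exists>d. q \<in> normal_polys i d) \<and> p - q \<in> spherical_ideal" using assms by blast
  fix r assume "(\<exists>d. r \<in> normal_polys i d) \<and> p - r \<in> spherical_ideal"
  then obtain e where e: "r \<in> normal_polys i e" "p - r \<in> spherical_ideal" by blast
  have "r - q \<in> normal_polys i (max d e)"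
    using assms(1) e(1) normal_polys_mono[of d "max d e" i] normal_polys_mono[of e "max d e" i]
    by (intro normal_polys_diff) auto
  moreover have "r - q \<in> spherical_ideal"
    using spherical_ideal_diff[OF assms(2) e(2)] by simp
  ultimately show "r = q" using normal_poly_in_ideal by fastforce
qed

lemma nf_degree: "nc_degree p \<le> d \<Longrightarrow> nf p \<in> normal_polys i d"
  and nf_congruent: "p - nf p \<in> spherical_ideal"
  using poly_reduction[of p d i] poly_reduction[of p "nc_degree p" i] nf_eqI by (metis order_refl)+

lemma nf_normal: "nf p \<in> normal_polys i (nc_degree p)"
  by (rule nf_degree) simp

lemma nf_eq_iff: "nf p = nf q \<longleftrightarrow> p - q \<in> spherical_ideal"
proof
  assume eq: "nf p = nf q"
  have "p - q = (p - nf p) - (q - nf q)" using eq by simp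
  then show "p - q \<in> spherical_ideal"
    using spherical_ideal_diff[OF nf_congruent nf_congruent] by metis
next
  assume "p - q \<in> spherical_ideal"
  then have "p - nf q \<in> spherical_ideal"
    using spherical_ideal_add[OF _ nf_congruent[of q]] by fastforce
  then show "nf p = nf q" by (rule nf_eqI[OF nf_normal])
qed

lemma nf_in_ideal: "x \<in> spherical_ideal \<Longrightarrow> nf x = 0"
  by (rule nf_eqI[OF pm.subspace_0[OF subspace_normal_polys]]) simp

lemma nf_add: "nf (p + q) = nf p + nf q"
proof (rule nf_eqI)
  let ?d = "max (nc_degree p) (nc_degree q)"
  show "nf p + nf q \<in> normal_polys i ?d"
    by (intro normal_polys_add nf_degree) auto
  have "p + q - (nf p + nf q) = (p - nf p) + (q - nf q)" by simp
  then show "p + q - (nf p + nf q) \<in> spherical_ideal"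
    by (simp only: spherical_ideal_add nf_congruent)
qed

lemma nf_smul: "nf (smul c p) = smul c (nf p)"
proof (rule nf_eqI)
  show "smul c (nf p) \<in> normal_polys i (nc_degree p)"
    by (intro normal_polys_smul nf_normal)
  have "smul c p - smul c (nf p) = smul c (p - nf p)"
    by (simp add: pm.scale_right_diff_distrib)
  then show "smul c p - smul c (nf p) \<in> spherical_ideal"
    by (simp only: spherical_ideal_smul nf_congruent)
qed

lemma nf_diff: "nf (p - q) = nf p - nf q"
  using nf_add[of "p - q" q] by simp

lemma nf_sum: "nf (\<Sum>k\<in>S. f k) = (\<Sum>k\<in>S. nf (f k))"
  by (induction S rule: infinite_finite_induct) (auto simp: nf_add nf_in_ideal)

text \<open>Downward induction on the length of \<open>z\<close>: in the representation attached to \<open>z\<close>, only \<open>z\<close>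
  and longer words contribute to the first coordinate, and the coefficients of the longer words are
  already bounded.\<close>

lemma coefficients_bounded:
  fixes P :: "nat \<Rightarrow> 'g ncpoly"
  assumes P: "\<And>k. P k \<in> normal_polys i d"
    and bounded: "\<And>A \<xi>. spherical_isometry (2 * (d + 1)) A \<Longrightarrow> \<xi> \<in> carrier_vec (2 * (d + 1)) \<Longrightarrow>
      \<exists>R. \<forall>k. cmod (lin (\<lambda>w. (word_eval (2 * (d + 1)) A w *\<^sub>v \<xi>) $ 0) (P k)) \<le> R"
  shows "\<exists>R. \<forall>k. cmod (Poly_Mapping.lookup (P k) z) \<le> R"
proof (induction "Suc d - length z" arbitrary: z rule: less_induct)
  case less
  show ?case
  proof (cases "z \<in> normal_words i d")
    case False
    then have "Poly_Mapping.lookup (P k) z = 0" for k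
      using P[of k] by (auto simp: normal_polys_def normal_words_def)
    then show ?thesis by (intro exI[of _ 0]) simp
  next
    case True
    let ?N = "2 * (d + 1)" and ?W = "normal_words i d"
    have "2 * (length z + 1) \<le> ?N" using True by (simp add: normal_words_def)
    from path_representation[OF distinct_indices this] obtain A \<xi>
      where A: "spherical_isometry ?N A" "\<xi> \<in> carrier_vec ?N"
        and short: "\<And>w. normal_word i w \<Longrightarrow> length w \<le> length z \<Longrightarrow>
          (word_eval ?N A w *\<^sub>v \<xi>) $ 0 = (if w = z then (1/2) ^ length z else 0)" by metis
    define F where "F w = (word_eval ?N A w *\<^sub>v \<xi>) $ 0" for w
    have F_short: "F w = (if w = z then (1/2) ^ length z else 0)"
      if "normal_word i w" "length w \<le> length z" for w
      unfolding F_def using that by (rule short)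
    obtain R0 where R0: "\<And>k. cmod (lin F (P k)) \<le> R0"
      using bounded[OF A] unfolding F_def by blast
    let ?long = "{w \<in> ?W. length z < length w}"
    have "\<exists>R. \<forall>k. cmod (Poly_Mapping.lookup (P k) w) \<le> R" if "w \<in> ?long" for w
      using that by (intro less) (auto simp: normal_words_def)
    then obtain R where R: "\<And>w k. w \<in> ?long \<Longrightarrow> cmod (Poly_Mapping.lookup (P k) w) \<le> R w"
      by metis
    define S where "S = (\<Sum>w\<in>?long. R w * cmod (F w))"
    have "cmod (Poly_Mapping.lookup (P k) z) \<le> 2 ^ length z * (R0 + S)" for k
    proof -
      have "lin F (P k) = (\<Sum>w\<in>?W. Poly_Mapping.lookup (P k) w * F w)"
        using P[of k] by (intro lin_superset) (auto simp: normal_polys_keys)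
      also have "\<dots> = (\<Sum>w\<in>?W. (if w = z then Poly_Mapping.lookup (P k) z * (1/2) ^ length z else 0)
          + (if length z < length w then Poly_Mapping.lookup (P k) w * F w else 0))"
        by (intro sum.cong refl) (auto simp: F_short normal_words_def not_less)
      also have "\<dots> = Poly_Mapping.lookup (P k) z * (1/2) ^ length z
          + (\<Sum>w\<in>?long. Poly_Mapping.lookup (P k) w * F w)"
        using True by (simp add: sum.distrib sum.inter_filter)
      finally have "cmod (Poly_Mapping.lookup (P k) z * (1/2) ^ length z) =
          cmod (lin F (P k) - (\<Sum>w\<in>?long. Poly_Mapping.lookup (P k) w * F w))" by simp
      also have "\<dots> \<le> cmod (lin F (P k)) + cmod (\<Sum>w\<in>?long. Poly_Mapping.lookup (P k) w * F w)"
        by (rule norm_triangle_ineq4)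
      also have "cmod (\<Sum>w\<in>?long. Poly_Mapping.lookup (P k) w * F w) \<le> S"
        unfolding S_def
        by (rule order_trans[OF norm_sum]) (intro sum_mono, auto simp: norm_mult intro!: mult_right_mono R)
      finally have "cmod (Poly_Mapping.lookup (P k) z) * (1/2) ^ length z \<le> R0 + S"
        using R0[of k] by (simp add: norm_mult norm_power norm_divide)
      then show ?thesis by (simp add: power_divide field_simps)
    qed
    then show ?thesis by blast
  qed
qed

end

section \<open>Separation from the sums of squares\<close>

lemma real_bounded_subsequence:
  fixes Y :: "nat \<Rightarrow> 'k \<Rightarrow> real"
  assumes "finite K" "\<And>k. k \<in> K \<Longrightarrow> \<exists>R. \<forall>n. \<bar>Y n k\<bar> \<le> R"
  shows "\<exists>\<sigma> l. strict_mono \<sigma> \<and> (\<forall>k\<in>K. (\<lambda>n. Y (\<sigma> n) k) \<longlonglongrightarrow> l k)"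
  using assms
proof (induction K)
  case empty
  show ?case by (rule exI[of _ id]) (simp add: strict_mono_def)
next
  case (insert a K)
  have "\<exists>\<sigma> l. strict_mono \<sigma> \<and> (\<forall>k\<in>K. (\<lambda>n. Y (\<sigma> n) k) \<longlonglongrightarrow> l k)"
    by (rule insert.IH) (use insert.prems in blast)
  then obtain \<sigma> l where \<sigma>: "strict_mono \<sigma>" and l: "\<And>k. k \<in> K \<Longrightarrow> (\<lambda>n. Y (\<sigma> n) k) \<longlonglongrightarrow> l k"
    by blast
  obtain R where R: "\<And>n. \<bar>Y n a\<bar> \<le> R" using insert.prems by blast
  obtain \<tau> where \<tau>: "strict_mono \<tau>" "monoseq (\<lambda>n. Y (\<sigma> (\<tau> n)) a)"
    using seq_monosub[of "\<lambda>n. Y (\<sigma> n) a"] by auto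
  have "Bseq (\<lambda>n. Y (\<sigma> (\<tau> n)) a)"
    using R by (intro BseqI'[of _ R]) simp
  then obtain la where la: "(\<lambda>n. Y (\<sigma> (\<tau> n)) a) \<longlonglongrightarrow> la"
    using Bseq_monoseq_convergent[OF _ \<tau>(2)] by (auto simp: convergent_def)
  have "(\<lambda>n. Y (\<sigma> (\<tau> n)) k) \<longlonglongrightarrow> l k" if "k \<in> K" for k
    using LIMSEQ_subseq_LIMSEQ[OF l[OF that] \<tau>(1)] by (simp add: o_def)
  then have "\<forall>k\<in>insert a K. (\<lambda>n. Y ((\<sigma> \<circ> \<tau>) n) k) \<longlonglongrightarrow> (l(a := la)) k"
    using la insert.hyps(2) by auto
  moreover have "strict_mono (\<sigma> \<circ> \<tau>)" using \<sigma> \<tau>(1) by (rule strict_mono_o)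
  ultimately show ?case by blast
qed

lemma complex_bounded_subsequence:
  fixes Y :: "nat \<Rightarrow> 'k \<Rightarrow> complex"
  assumes "finite K" and bounded: "\<And>k. k \<in> K \<Longrightarrow> \<exists>R. \<forall>n. cmod (Y n k) \<le> R"
  obtains \<sigma> l where "strict_mono \<sigma>" "\<And>k. k \<in> K \<Longrightarrow> (\<lambda>n. Y (\<sigma> n) k) \<longlonglongrightarrow> l k"
proof -
  let ?Y = "\<lambda>n (k, re). if re then Re (Y n k) else Im (Y n k)"
  have Y: "\<exists>R. \<forall>n. \<bar>?Y n x\<bar> \<le> R" if x: "x \<in> K \<times> UNIV" for x
  proof -
    have "fst x \<in> K" using x by auto
    then obtain R where "\<And>n. cmod (Y n (fst x)) \<le> R" using bounded by blast
    then have "\<bar>?Y n x\<bar> \<le> R" for n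
      using abs_Re_le_cmod[of "Y n (fst x)"] abs_Im_le_cmod[of "Y n (fst x)"]
      by (auto simp: case_prod_beta intro: order_trans)
    then show ?thesis by blast
  qed
  have "finite (K \<times> (UNIV :: bool set))" using assms(1) by simp
  from real_bounded_subsequence[OF this, where Y = ?Y, OF Y]
  obtain \<sigma> l where \<sigma>: "strict_mono \<sigma>" and l: "\<forall>x\<in>K \<times> UNIV. (\<lambda>n. ?Y (\<sigma> n) x) \<longlonglongrightarrow> l x"
    by blast
  have "(\<lambda>n. Y (\<sigma> n) k) \<longlonglongrightarrow> Complex (l (k, True)) (l (k, False))" if "k \<in> K" for k
    using bspec[OF l, of "(k, True)"] bspec[OF l, of "(k, False)"] that by (simp add: tendsto_complex_iff)
  with \<sigma> show ?thesis by (rule that)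
qed

definition sos_cone :: "nat \<Rightarrow> 'g ncpoly set" where
  "sos_cone d = {c. \<exists>ps. (\<forall>p\<in>set ps. nc_degree p \<le> d) \<and> c = (\<Sum>p\<leftarrow>ps. nc_star p * p)}"

lemma sos_cone_square: "nc_degree p \<le> d \<Longrightarrow> nc_star p * p \<in> sos_cone d"
  unfolding sos_cone_def by (intro CollectI exI[of _ "[p]"]) simp

lemma sos_cone_zero: "0 \<in> sos_cone d"
  unfolding sos_cone_def by (intro CollectI exI[of _ "[]"]) simp

lemma sos_cone_add: "a \<in> sos_cone d \<Longrightarrow> b \<in> sos_cone d \<Longrightarrow> a + b \<in> sos_cone d"
proof -
  assume "a \<in> sos_cone d" "b \<in> sos_cone d"
  then obtain ps qs where "\<forall>p\<in>set ps. nc_degree p \<le> d" "a = (\<Sum>p\<leftarrow>ps. nc_star p * p)"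
      "\<forall>p\<in>set qs. nc_degree p \<le> d" "b = (\<Sum>p\<leftarrow>qs. nc_star p * p)"
    unfolding sos_cone_def by blast
  then show ?thesis
    unfolding sos_cone_def by (intro CollectI exI[of _ "ps @ qs"]) auto
qed

lemma sos_cone_sum: "(\<And>k. k \<in> S \<Longrightarrow> f k \<in> sos_cone d) \<Longrightarrow> (\<Sum>k\<in>S. f k) \<in> sos_cone d"
  by (induction S rule: infinite_finite_induct) (auto simp: sos_cone_zero intro: sos_cone_add)

lemma square_smul: "nc_star (smul c p) * smul c p = smul (cnj c * c) (nc_star p * p)"
  by (simp add: nc_star_smul smul_mult_left smul_mult_right mult.commute)

lemma nc_degree_smul: "nc_degree p \<le> d \<Longrightarrow> nc_degree (smul c p) \<le> d"
  by (auto simp: nc_degree_le_iff in_keys_iff)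

lemma sos_cone_scale:
  assumes "a \<in> sos_cone d" "0 \<le> t" shows "smul (complex_of_real t) a \<in> sos_cone d"
proof -
  obtain ps where ps: "\<forall>p\<in>set ps. nc_degree p \<le> d" "a = (\<Sum>p\<leftarrow>ps. nc_star p * p)"
    using assms(1) unfolding sos_cone_def by blast
  let ?c = "complex_of_real (sqrt t)"
  have c: "cnj ?c * ?c = complex_of_real t" using assms(2) by (simp flip: of_real_mult)
  have "smul (complex_of_real t) (\<Sum>p\<leftarrow>qs. nc_star p * p) = (\<Sum>p\<leftarrow>map (smul ?c) qs. nc_star p * p)"
    for qs :: "'a ncpoly list"
    by (induction qs) (simp_all only: list.map sum_list.Nil sum_list.Cons pm.scale_zero_right pm.scale_right_distrib square_smul c)
  then show ?thesis
    using ps unfolding sos_cone_def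
    by (intro CollectI exI[of _ "map (smul ?c) ps"]) (auto intro: nc_degree_smul)
qed

lemma nc_degree_mult_le: "nc_degree p \<le> a \<Longrightarrow> nc_degree q \<le> b \<Longrightarrow> nc_degree (p * q) \<le> a + b"
proof -
  assume "nc_degree p \<le> a" "nc_degree q \<le> b"
  then show ?thesis
    using keys_mult[of p q] unfolding nc_degree_le_iff
    by (fastforce simp: plus_list_def)
qed

lemma nc_degree_add_le: "nc_degree p \<le> d \<Longrightarrow> nc_degree q \<le> d \<Longrightarrow> nc_degree (p + q) \<le> d"
  using keys_add[of p q] by (auto simp: nc_degree_le_iff)

lemma nc_degree_uminus [simp]: "nc_degree (- p) = nc_degree p"
proof -
  have "Poly_Mapping.keys (- p) = Poly_Mapping.keys p" by (auto simp: in_keys_iff)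
  then show ?thesis by (simp add: nc_degree_def)
qed

lemma nc_degree_diff_le: "nc_degree p \<le> d \<Longrightarrow> nc_degree q \<le> d \<Longrightarrow> nc_degree (p - q) \<le> d"
  using nc_degree_add_le[of p d "- q"] by simp

lemma nc_degree_zero [simp]: "nc_degree 0 = 0" by (simp add: nc_degree_def)

lemma nc_degree_star [simp]: "nc_degree (nc_star p) = nc_degree p"
  by (simp add: nc_degree_def keys_nc_star image_image)

lemma normal_polys_degree: "p \<in> normal_polys i d \<Longrightarrow> nc_degree p \<le> d"
  by (auto simp: normal_polys_def nc_degree_le_iff in_keys_iff)

lemma nc_degree_sos: "c \<in> sos_cone d \<Longrightarrow> nc_degree c \<le> 2 * d"
proof -
  assume "c \<in> sos_cone d"
  then obtain ps where ps: "\<forall>p\<in>set ps. nc_degree p \<le> d" "c = (\<Sum>p\<leftarrow>ps. nc_star p * p)"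
    unfolding sos_cone_def by blast
  have "nc_degree (\<Sum>p\<leftarrow>ps. nc_star p * p) \<le> 2 * d"
    using ps(1)
  proof (induction ps)
    case (Cons p ps)
    have "nc_degree (nc_star p * p) \<le> d + d"
      by (rule nc_degree_mult_le) (use Cons.prems in auto)
    then show ?case using Cons by (auto intro: nc_degree_add_le)
  qed simp
  then show ?thesis by (simp add: ps)
qed

text \<open>First-order optimality condition: with \<open>a\<close> positive, the linear term would dominate for small
  \<open>t\<close>.\<close>

lemma quadratic_perturbation:
  assumes min: "\<And>t. 0 < t \<Longrightarrow> t < 1 \<Longrightarrow> 0 \<le> - (2 * t * a) + t\<^sup>2 * b"
  shows "a \<le> (0 :: real)"
proof (rule ccontr)
  assume "\<not> a \<le> 0"
  then have a: "a > 0" by simp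
  define t where "t = min (1/2) (a / (\<bar>b\<bar> + 1))"
  have t: "0 < t" "t < 1" using a by (auto simp: t_def)
  have "t * \<bar>b\<bar> < 2 * a"
  proof -
    have "t * \<bar>b\<bar> \<le> a / (\<bar>b\<bar> + 1) * \<bar>b\<bar>" unfolding t_def by (intro mult_right_mono) auto
    also have "\<dots> \<le> a" using a by (simp add: field_simps)
    finally show ?thesis using a by simp
  qed
  then have "t * (t * \<bar>b\<bar>) < t * (2 * a)" using t(1) by (rule mult_strict_left_mono)
  moreover have "t\<^sup>2 * b \<le> t * (t * \<bar>b\<bar>)"
    using t(1) by (simp add: power2_eq_square mult_left_mono)
  ultimately show False using min[OF t] by (simp add: mult_ac)
qed

context two_indices
begin

text \<open>Sums of squares are parametrised by matrices \<open>B\<close> whose rows are the coefficient vectors of the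
  squared polynomials. The number of rows is fixed, so that compactness in a finite-dimensional
  space applies.\<close>

definition combination :: "nat \<Rightarrow> ('g letter list \<Rightarrow> complex) \<Rightarrow> 'g ncpoly" where
  "combination d b = (\<Sum>u\<in>normal_words i d. Poly_Mapping.single u (b u))"

definition sos :: "nat \<Rightarrow> (nat \<Rightarrow> 'g letter list \<Rightarrow> complex) \<Rightarrow> 'g ncpoly" where
  "sos d B = (\<Sum>r<card (normal_words i d). nc_star (combination d (B r)) * combination d (B r))"

lemma lookup_combination:
  "Poly_Mapping.lookup (combination d b) u = (if u \<in> normal_words i d then b u else 0)"
proof -
  have "Poly_Mapping.lookup (combination d b) u = (\<Sum>v\<in>normal_words i d. if v = u then b u else 0)"
    unfolding combination_def lookup_sum by (intro sum.cong refl) (auto simp: lookup_single when_def)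
  then show ?thesis by simp
qed

lemma combination_normal: "combination d b \<in> normal_polys i d"
  by (auto simp: normal_polys_keys in_keys_iff lookup_combination split: if_splits)

lemma square_expand:
  assumes "q \<in> normal_polys i d"
  shows "nc_star q * q = (\<Sum>u\<in>normal_words i d. \<Sum>v\<in>normal_words i d.
    smul (cnj (Poly_Mapping.lookup q u) * Poly_Mapping.lookup q v) (Poly_Mapping.single (word_star u @ v) 1))"
proof -
  have "q = combination d (Poly_Mapping.lookup q)"
    using assms by (intro poly_mapping_eqI) (auto simp: lookup_combination normal_polys_def normal_words_def)
  then have "nc_star q * q = nc_star (combination d (Poly_Mapping.lookup q)) * combination d (Poly_Mapping.lookup q)"
    by simp
  also have "\<dots> = (\<Sum>u\<in>normal_words i d. \<Sum>v\<in>normal_words i d.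
    smul (cnj (Poly_Mapping.lookup q u) * Poly_Mapping.lookup q v) (Poly_Mapping.single (word_star u @ v) 1))"
    unfolding combination_def
    by (simp add: nc_star_sum nc_star_single sum_product mult_single plus_list_def smul_single)
  finally show ?thesis .
qed

lemma sos_in_cone: "sos d B \<in> sos_cone d"
  unfolding sos_def
  by (intro sos_cone_sum sos_cone_square normal_polys_degree[OF combination_normal])

lemma sos_expand:
  "sos d B = (\<Sum>u\<in>normal_words i d. \<Sum>v\<in>normal_words i d.
    smul (\<Sum>r<card (normal_words i d). cnj (B r u) * B r v) (Poly_Mapping.single (word_star u @ v) 1))"
proof -
  have "sos d B = (\<Sum>r<card (normal_words i d). \<Sum>u\<in>normal_words i d. \<Sum>v\<in>normal_words i d.
    smul (cnj (B r u) * B r v) (Poly_Mapping.single (word_star u @ v) 1))"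
    unfolding sos_def
    by (simp add: square_expand[OF combination_normal] lookup_combination)
  also have "\<dots> = (\<Sum>u\<in>normal_words i d. \<Sum>r<card (normal_words i d). \<Sum>v\<in>normal_words i d.
    smul (cnj (B r u) * B r v) (Poly_Mapping.single (word_star u @ v) 1))"
    by (rule sum.swap)
  also have "\<dots> = (\<Sum>u\<in>normal_words i d. \<Sum>v\<in>normal_words i d. \<Sum>r<card (normal_words i d).
    smul (cnj (B r u) * B r v) (Poly_Mapping.single (word_star u @ v) 1))"
    by (intro sum.cong refl sum.swap)
  finally show ?thesis by (simp only: pm.scale_sum_left)
qed

text \<open>Modulo the ideal a sum of squares depends only on the Gram matrix of the normal forms of its
  polynomials, and a Gram matrix factors with as many rows as there are normal words.\<close>

lemma sos_normalise:
  assumes "c \<in> sos_cone d"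
  shows "\<exists>B. c - sos d B \<in> spherical_ideal"
proof -
  obtain ps where ps: "\<forall>p\<in>set ps. nc_degree p \<le> d" "c = (\<Sum>p\<leftarrow>ps. nc_star p * p)"
    using assms unfolding sos_cone_def by blast
  let ?W = "normal_words i d"
  define q where "q k = nf (ps ! k)" for k
  have q: "q k \<in> normal_polys i d" if "k < length ps" for k
    unfolding q_def using ps(1) that by (intro nf_degree) auto
  define M where "M u v = (\<Sum>k<length ps. cnj (Poly_Mapping.lookup (q k) u) * Poly_Mapping.lookup (q k) v)" for u v
  have "\<exists>D. \<forall>u\<in>?W. \<forall>v\<in>?W. M u v = (\<Sum>r<card ?W. cnj (D r u) * D r v)"
  proof (rule gram_factorisation)
    show "M v u = cnj (M u v)" for u v by (simp add: M_def mult.commute)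
    fix b :: "'g letter list \<Rightarrow> complex"
    show "0 \<le> Re (\<Sum>u\<in>?W. \<Sum>v\<in>?W. cnj (b u) * M u v * b v)"
      unfolding M_def gram_quadratic_form by (simp add: sum_nonneg)
  qed simp
  then obtain B where B: "\<And>u v. u \<in> ?W \<Longrightarrow> v \<in> ?W \<Longrightarrow> M u v = (\<Sum>r<card ?W. cnj (B r u) * B r v)"
    by blast
  have "sos d B = (\<Sum>u\<in>?W. \<Sum>v\<in>?W. smul (M u v) (Poly_Mapping.single (word_star u @ v) 1))"
    unfolding sos_expand by (intro sum.cong refl) (simp add: B)
  also have "\<dots> = (\<Sum>u\<in>?W. \<Sum>v\<in>?W. \<Sum>k<length ps. smul (cnj (Poly_Mapping.lookup (q k) u) * Poly_Mapping.lookup (q k) v)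
      (Poly_Mapping.single (word_star u @ v) 1))"
    by (simp only: M_def pm.scale_sum_left)
  also have "\<dots> = (\<Sum>u\<in>?W. \<Sum>k<length ps. \<Sum>v\<in>?W. smul (cnj (Poly_Mapping.lookup (q k) u) * Poly_Mapping.lookup (q k) v)
      (Poly_Mapping.single (word_star u @ v) 1))"
    by (intro sum.cong refl sum.swap)
  also have "\<dots> = (\<Sum>k<length ps. \<Sum>u\<in>?W. \<Sum>v\<in>?W. smul (cnj (Poly_Mapping.lookup (q k) u) * Poly_Mapping.lookup (q k) v)
      (Poly_Mapping.single (word_star u @ v) 1))"
    by (rule sum.swap)
  also have "\<dots> = (\<Sum>k<length ps. nc_star (q k) * q k)"
    by (intro sum.cong refl) (simp add: square_expand[OF q])
  finally have sos: "sos d B = (\<Sum>k<length ps. nc_star (q k) * q k)" .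
  have c: "c = (\<Sum>k<length ps. nc_star (ps ! k) * (ps ! k))"
    by (simp add: ps(2) sum_list_sum_nth lessThan_atLeast0)
  have "c - sos d B = (\<Sum>k<length ps. nc_star (ps ! k - q k) * (ps ! k) + nc_star (q k) * (ps ! k - q k))"
    unfolding c sos sum_subtractf[symmetric] by (intro sum.cong refl) (simp add: nc_star_diff algebra_simps)
  also have "\<dots> \<in> spherical_ideal"
    unfolding q_def
    by (intro spherical_ideal_sum spherical_ideal_add spherical_ideal_mult_left[OF nf_congruent]
        spherical_ideal_mult_right[OF nc_star_in_ideal[OF nf_congruent]])
  finally show ?thesis by blast
qed

text \<open>The squared distance of \<open>h\<close> from the ideal, measured in the coefficients of the normal form. The
  bound \<open>2 * d\<close> covers squares of polynomials of degree \<open>d\<close>.\<close>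

definition sq_dist :: "nat \<Rightarrow> 'g ncpoly \<Rightarrow> real" where
  "sq_dist d h = (\<Sum>w\<in>normal_words i (2 * d). (cmod (Poly_Mapping.lookup (nf h) w))\<^sup>2)"

lemma sq_dist_nonneg: "0 \<le> sq_dist d h"
  by (simp add: sq_dist_def sum_nonneg)

lemma sq_dist_cong: "g - h \<in> spherical_ideal \<Longrightarrow> sq_dist d g = sq_dist d h"
  by (simp add: sq_dist_def flip: nf_eq_iff)

lemma sq_dist_zero:
  assumes "nc_degree h \<le> 2 * d" "sq_dist d h = 0" shows "h \<in> spherical_ideal"
proof -
  have "\<forall>w\<in>normal_words i (2 * d). (cmod (Poly_Mapping.lookup (nf h) w))\<^sup>2 = 0"
    using assms(2) by (simp only: sq_dist_def sum_nonneg_eq_0_iff[OF finite_normal_words zero_le_power2])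
  then have "Poly_Mapping.lookup (nf h) w = 0" for w
    using nf_degree[OF assms(1)]
    by (cases "w \<in> normal_words i (2 * d)") (auto simp: normal_polys_keys in_keys_iff)
  then have "nf h = 0" by (intro poly_mapping_eqI) simp
  then show ?thesis using nf_congruent[of h] by simp
qed

lemma lookup_nf_residual:
  "Poly_Mapping.lookup (nf (f - sos d B)) w = Poly_Mapping.lookup (nf f) w -
     (\<Sum>u\<in>normal_words i d. \<Sum>v\<in>normal_words i d. (\<Sum>r<card (normal_words i d). cnj (B r u) * B r v) *
        Poly_Mapping.lookup (nf (Poly_Mapping.single (word_star u @ v) 1)) w)"
  by (simp add: nf_diff lookup_minus sos_expand nf_sum nf_smul lookup_sum)

lemma lin_spherical_bounded:
  assumes A: "spherical_isometry n A" and x: "x \<in> carrier_vec n" and deg: "nc_degree h \<le> 2 * d"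
    and b: "sq_dist d h \<le> b"
  shows "cmod (lin (\<lambda>w. (word_eval n A w *\<^sub>v x) \<bullet>c x) h)
      \<le> (\<Sum>w\<in>normal_words i (2 * d). sqrt b * cmod ((word_eval n A w *\<^sub>v x) \<bullet>c x))"
proof -
  let ?F = "\<lambda>w. (word_eval n A w *\<^sub>v x) \<bullet>c x" and ?W = "normal_words i (2 * d)"
  have "lin ?F h = lin ?F (nf h)"
    using lin_spherical_ideal(2)[OF A nf_congruent x, of h] by (simp add: lin_diff)
  also have "\<dots> = (\<Sum>w\<in>?W. Poly_Mapping.lookup (nf h) w * ?F w)"
    using nf_degree[OF deg] by (intro lin_superset) (auto simp: normal_polys_keys)
  finally have "cmod (lin ?F h) \<le> (\<Sum>w\<in>?W. cmod (Poly_Mapping.lookup (nf h) w * ?F w))"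
    by (simp add: norm_sum)
  also have "\<dots> \<le> (\<Sum>w\<in>?W. sqrt b * cmod (?F w))"
  proof (intro sum_mono)
    fix w assume "w \<in> ?W"
    then have "(cmod (Poly_Mapping.lookup (nf h) w))\<^sup>2 \<le> sq_dist d h"
      unfolding sq_dist_def by (intro member_le_sum) auto
    then have "cmod (Poly_Mapping.lookup (nf h) w) \<le> sqrt b"
      using b by (intro real_le_rsqrt) linarith
    then show "cmod (Poly_Mapping.lookup (nf h) w * ?F w) \<le> sqrt b * cmod (?F w)"
      by (simp add: norm_mult mult_right_mono)
  qed
  finally show ?thesis .
qed

text \<open>Along a minimising sequence the sums of squares stay bounded modulo the ideal, so their values
  on each spherical isometry stay bounded. These values are sums of squared lengths, without
  cancellation, hence each squared polynomial is bounded on each spherical isometry and so are its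
  coefficients. A convergent subsequence yields the minimiser.\<close>

lemma nearest_sos:
  assumes f: "nc_degree f \<le> 2 * d"
  shows "\<exists>B. \<forall>c\<in>sos_cone d. sq_dist d (f - sos d B) \<le> sq_dist d (f - c)"
proof -
  let ?W = "normal_words i d" and ?n = "card (normal_words i d)" and ?N = "2 * (d + 1)"
  define \<delta> where "\<delta> = (INF B. sq_dist d (f - sos d B))"
  have bdd: "bdd_below (range (\<lambda>B. sq_dist d (f - sos d B)))"
    by (rule bdd_belowI[of _ 0]) (auto simp: sq_dist_nonneg)
  have "\<exists>B. sq_dist d (f - sos d B) < \<delta> + 1 / real (Suc k)" for k
    using cINF_less_iff[OF _ bdd, of "\<delta> + 1 / real (Suc k)"] by (auto simp: \<delta>_def)
  then obtain B where B: "\<And>k. sq_dist d (f - sos d (B k)) < \<delta> + 1 / real (Suc k)"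
    by metis
  have B1: "sq_dist d (f - sos d (B k)) \<le> \<delta> + 1" for k
  proof -
    have "1 / real (Suc k) \<le> 1" by simp
    then show ?thesis using B[of k] by linarith
  qed
  have deg: "nc_degree (f - sos d (B k)) \<le> 2 * d" for k
    using f nc_degree_sos[OF sos_in_cone] by (rule nc_degree_diff_le)
  have coeff: "\<exists>R. \<forall>k. cmod (Poly_Mapping.lookup (combination d (B k r)) u) \<le> R" if r: "r < ?n" for r u
  proof (rule coefficients_bounded[OF combination_normal])
    fix A :: "'g \<Rightarrow> complex mat" and x :: "complex vec"
    assume A: "spherical_isometry ?N A" and x: "x \<in> carrier_vec ?N"
    have carr: "\<And>j. A j \<in> carrier_mat ?N ?N" using spherical_isometryD(1)[OF A] .
    let ?F = "\<lambda>w. (word_eval ?N A w *\<^sub>v x) \<bullet>c x" and ?G = "\<lambda>w. (word_eval ?N A w *\<^sub>v x) $ 0"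
    define R where "R = cmod (lin ?F f) + (\<Sum>w\<in>normal_words i (2 * d). sqrt (\<delta> + 1) * cmod (?F w))"
    have "(cmod (lin ?G (combination d (B k r))))\<^sup>2 \<le> R" for k
    proof -
      define e where "e s = (\<Sum>t<?N. (cmod (lin (\<lambda>w. (word_eval ?N A w *\<^sub>v x) $ t) (combination d (B k s))))\<^sup>2)" for s
      have e_nonneg: "0 \<le> e s" for s by (simp add: e_def sum_nonneg)
      have "(cmod (lin ?G (combination d (B k r))))\<^sup>2 \<le> e r"
        unfolding e_def by (rule member_le_sum[where i = 0]) auto
      also have "\<dots> \<le> (\<Sum>s<?n. e s)"
        using r e_nonneg by (intro member_le_sum) auto
      also have "complex_of_real (\<Sum>s<?n. e s) = lin ?F (sos d (B k))"
        unfolding sos_def lin_sum of_real_sum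
        by (intro sum.cong refl) (simp only: e_def eval_square[OF carr x])
      then have "(\<Sum>s<?n. e s) \<le> cmod (lin ?F (sos d (B k)))"
        by (metis abs_le_D1 norm_of_real order_refl)
      also have "lin ?F (sos d (B k)) = lin ?F f - lin ?F (f - sos d (B k))"
        by (simp add: lin_diff)
      also have "cmod \<dots> \<le> R"
        unfolding R_def
        by (rule order_trans[OF norm_triangle_ineq4])
           (intro add_mono order_refl lin_spherical_bounded[OF A x deg B1])
      finally show ?thesis .
    qed
    then have "cmod (lin ?G (combination d (B k r))) \<le> sqrt R" for k
      by (intro real_le_rsqrt)
    then show "\<exists>R. \<forall>k. cmod (lin ?G (combination d (B k r))) \<le> R" by blast
  qed
  have entries: "\<exists>R. \<forall>k. cmod (B k (fst y) (snd y)) \<le> R" if "y \<in> {..<?n} \<times> ?W" for y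
    using coeff[of "fst y" "snd y"] that by (auto simp: lookup_combination)
  have fin: "finite ({..<?n} \<times> ?W)" by simp
  obtain \<sigma> l where \<sigma>: "strict_mono \<sigma>"
    and l: "\<And>y. y \<in> {..<?n} \<times> ?W \<Longrightarrow> (\<lambda>k. B (\<sigma> k) (fst y) (snd y)) \<longlonglongrightarrow> l y"
    using complex_bounded_subsequence[OF fin, where Y = "\<lambda>k y. B k (fst y) (snd y)", OF entries] by blast
  define B' where "B' r u = l (r, u)" for r u
  have lim: "(\<lambda>k. B (\<sigma> k) r u) \<longlonglongrightarrow> B' r u" if "r \<in> {..<?n}" "u \<in> ?W" for r u
    using l[of "(r, u)"] that by (simp add: B'_def)
  have "(\<lambda>k. sq_dist d (f - sos d (B (\<sigma> k)))) \<longlonglongrightarrow> sq_dist d (f - sos d B')"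
    unfolding sq_dist_def lookup_nf_residual by (intro tendsto_intros lim; assumption)
  moreover have "(\<lambda>k. \<delta> + 1 / real (Suc (\<sigma> k))) \<longlonglongrightarrow> \<delta> + 0"
    using LIMSEQ_subseq_LIMSEQ[OF LIMSEQ_inverse_real_of_nat \<sigma>]
    by (intro tendsto_intros) (simp add: o_def inverse_eq_divide)
  ultimately have le: "sq_dist d (f - sos d B') \<le> \<delta>"
    using B by (intro LIMSEQ_le[where Y = "\<lambda>k. \<delta> + 1 / real (Suc (\<sigma> k))"]) (auto intro: less_imp_le)
  have "sq_dist d (f - sos d B') \<le> sq_dist d (f - c)" if c: "c \<in> sos_cone d" for c
  proof -
    obtain C where C: "c - sos d C \<in> spherical_ideal" using sos_normalise[OF c] by blast
    have "(f - sos d C) - (f - c) \<in> spherical_ideal" using C by simp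
    then have "sq_dist d (f - c) = sq_dist d (f - sos d C)" using sq_dist_cong by metis
    moreover have "\<delta> \<le> sq_dist d (f - sos d C)"
      unfolding \<delta>_def by (rule cINF_lower[OF bdd]) simp
    ultimately show ?thesis using le by simp
  qed
  then show ?thesis by blast
qed

text \<open>The functional is the inner product with the residual \<open>r\<close> of a nearest sum of squares, with the
  opposite sign. Adding a small multiple of \<open>c\<close> to the nearest point cannot decrease the
  distance, which gives the sign on \<open>c\<close>; shrinking the nearest point cannot decrease it either,
  which gives the sign on \<open>f\<close>.\<close>

lemma sos_separation:
  fixes f :: "'g ncpoly"
  assumes f: "nc_degree f \<le> 2 * d" and out: "\<And>c. c \<in> sos_cone d \<Longrightarrow> f - c \<notin> spherical_ideal"
  shows "\<exists>L. (\<forall>p q. L (p + q) = L p + L q) \<and> (\<forall>c p. L (smul c p) = c * L p) \<and>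
    (\<forall>p\<in>spherical_ideal. L p = 0) \<and> (\<forall>p. nc_degree p \<le> d \<longrightarrow> 0 \<le> Re (L (nc_star p * p))) \<and> Re (L f) < 0"
proof -
  obtain B where B: "\<And>c. c \<in> sos_cone d \<Longrightarrow> sq_dist d (f - sos d B) \<le> sq_dist d (f - c)"
    using nearest_sos[OF f] by blast
  let ?W = "normal_words i (2 * d)"
  define r where "r w = Poly_Mapping.lookup (nf (f - sos d B)) w" for w
  define S where "S p = (\<Sum>w\<in>?W. Poly_Mapping.lookup (nf p) w * cnj (r w))" for p
  have S_add: "S (p + q) = S p + S q" for p q
    by (simp add: S_def nf_add lookup_add distrib_right sum.distrib)
  have S_smul: "S (smul c p) = c * S p" for c p
    by (simp add: S_def nf_smul sum_distrib_left mult.assoc)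
  have S_ideal: "S p = 0" if "p \<in> spherical_ideal" for p
    using that by (simp add: S_def nf_in_ideal)
  have perturb: "sq_dist d (f - (sos d B + smul (complex_of_real t) c)) =
      sq_dist d (f - sos d B) - 2 * t * Re (S c) + t\<^sup>2 * sq_dist d c" for t c
  proof -
    have cmod_sq: "(cmod (x - complex_of_real t * y))\<^sup>2 = (cmod x)\<^sup>2 - 2 * t * Re (y * cnj x) + t\<^sup>2 * (cmod y)\<^sup>2" for x y
      unfolding cmod_power2 by (simp add: power2_eq_square algebra_simps)
    have "nf (f - (sos d B + smul (complex_of_real t) c)) = nf (f - sos d B) - smul (complex_of_real t) (nf c)"
      by (simp add: nf_diff nf_add nf_smul)
    then show ?thesis
      unfolding sq_dist_def S_def Re_sum sum_distrib_left sum_subtractf[symmetric] sum.distrib[symmetric]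
      by (intro sum.cong refl) (simp only: lookup_minus lookup_smul cmod_sq r_def)
  qed
  have nonpos: "Re (S c) \<le> 0" if c: "c \<in> sos_cone d" for c
  proof (rule quadratic_perturbation)
    fix t :: real assume "0 < t"
    then have "sos d B + smul (complex_of_real t) c \<in> sos_cone d"
      using c by (intro sos_cone_add sos_in_cone sos_cone_scale) auto
    from B[OF this] show "0 \<le> - (2 * t * Re (S c)) + t\<^sup>2 * sq_dist d c"
      by (simp add: perturb)
  qed
  have nonneg: "- Re (S (sos d B)) \<le> 0"
  proof (rule quadratic_perturbation)
    fix t :: real assume t: "0 < t" "t < 1"
    have "sos d B + smul (complex_of_real (- t)) (sos d B) = smul (complex_of_real (1 - t)) (sos d B)"
      by (intro poly_mapping_eqI) (simp add: lookup_add algebra_simps)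
    also have "\<dots> \<in> sos_cone d" using t by (intro sos_cone_scale sos_in_cone) simp
    finally show "0 \<le> - (2 * t * - Re (S (sos d B))) + t\<^sup>2 * sq_dist d (sos d B)"
      using B perturb[of "- t" "sos d B"] by fastforce
  qed
  have deg: "nc_degree (f - sos d B) \<le> 2 * d"
    using f nc_degree_sos[OF sos_in_cone] by (rule nc_degree_diff_le)
  have "sq_dist d (f - sos d B) \<noteq> 0"
    using sq_dist_zero[OF deg] out[OF sos_in_cone] by blast
  then have pos: "0 < sq_dist d (f - sos d B)"
    using sq_dist_nonneg[of d "f - sos d B"] by linarith
  have "S (f - sos d B) = complex_of_real (sq_dist d (f - sos d B))"
    unfolding S_def r_def[symmetric] sq_dist_def of_real_sum complex_norm_square ..
  moreover have "S f = S (f - sos d B) + S (sos d B)"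
    by (simp flip: S_add)
  ultimately have "Re (S f) > 0" using pos nonneg by simp
  then show ?thesis
    using nonpos[OF sos_cone_square]
    by (intro exI[of _ "\<lambda>p. - S p"]) (simp add: S_add S_smul S_ideal)
qed

end

section \<open>The Gelfand-Naimark-Segal construction\<close>

lemma nc_degree_single: "nc_degree (Poly_Mapping.single w c) \<le> length w"
  by (simp add: nc_degree_le_iff)

text \<open>Words of length at most \<open>e\<close> in \<open>k\<close> letters, padded with a blank letter at the end, embed into the
  words of length \<open>e\<close> in \<open>k + 1\<close> letters.\<close>

lemma geometric_sum_le: "(\<Sum>n\<le>e. k ^ n) \<le> (k + 1) ^ e" for k :: nat
proof (induction e)
  case (Suc e)
  have "(\<Sum>n\<le>Suc e. k ^ n) = 1 + k * (\<Sum>n\<le>e. k ^ n)"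
    by (subst sum.atMost_Suc_shift) (simp add: sum_distrib_left)
  also have "\<dots> \<le> (k + 1) ^ e + k * (k + 1) ^ e"
    using Suc.IH by (intro add_mono mult_left_mono) auto
  finally show ?case by (simp add: algebra_simps)
qed simp

lemma card_words_le: "card {w :: 'g::finite letter list. length w \<le> e} \<le> (2 * CARD('g) + 1) ^ e"
proof -
  have "CARD('g letter) \<le> card (range X :: 'g letter set) + card (range XT :: 'g letter set)"
    unfolding UNIV_letter by (rule card_Un_le)
  also have "\<dots> \<le> CARD('g) + CARD('g)"
    by (intro add_mono card_image_le) auto
  finally have letters: "CARD('g letter) \<le> 2 * CARD('g)" by simp
  have "card {w :: 'g letter list. length w \<le> e} = (\<Sum>n\<le>e. CARD('g letter) ^ n)"
    using card_lists_length_le[of "UNIV :: 'g letter set" e] by simp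
  also have "\<dots> \<le> (CARD('g letter) + 1) ^ e" by (rule geometric_sum_le)
  also have "\<dots> \<le> (2 * CARD('g) + 1) ^ e"
    using letters by (intro power_mono) auto
  finally show ?thesis .
qed

lemma poly_expand_words:
  fixes p :: "'g::finite ncpoly"
  assumes "nc_degree p \<le> e"
  shows "p = (\<Sum>w | length w \<le> e. smul (Poly_Mapping.lookup p w) (Poly_Mapping.single w 1))"
proof -
  have "(\<Sum>w\<in>Poly_Mapping.keys p. smul (Poly_Mapping.lookup p w) (Poly_Mapping.single w 1)) =
      (\<Sum>w | length w \<le> e. smul (Poly_Mapping.lookup p w) (Poly_Mapping.single w 1))"
    using assms by (intro sum.mono_neutral_left finite_words_le) (auto simp: nc_degree_le_iff in_keys_iff)
  then show ?thesis using poly_mapping_expand[of p] by (simp add: smul_single)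
qed

text \<open>In coordinates with respect to an orthonormal system \<open>b\<close> of polynomials of degree at most
  \<open>d - 1\<close>, the matrices \<open>a\<^sub>j\<close> are compressed multiplications by \<open>x\<^sub>j\<close>. The inner product
  is positive up to degree \<open>d\<close>, which is what Bessel's inequality for \<open>x\<^sub>j p\<close> uses; it also
  allows null vectors of degree at most \<open>d - 1\<close> to be tested against \<open>x\<^sub>j b\<^sub>r\<close>. If \<open>p\<close>
  and all \<open>x\<^sub>j p\<close> have degree at most \<open>d - 1\<close>, the projection loses no length, so the
  defect kills \<open>p\<close> and the dilation acts on it by multiplication.\<close>

lemma gns_spherical_isometry:
  fixes L :: "'g::finite ncpoly \<Rightarrow> complex"
  assumes ij: "i \<noteq> (j :: 'g)" and d: "d \<ge> 1" and N: "2 * (2 * CARD('g) + 1) ^ (d - 1) \<le> N"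
    and L_add: "\<And>p q. L (p + q) = L p + L q" and L_smul: "\<And>c p. L (smul c p) = c * L p"
    and L_ideal: "\<And>p. p \<in> spherical_ideal \<Longrightarrow> L p = 0"
    and L_star: "\<And>p. L (nc_star p) = cnj (L p)"
    and L_pos: "\<And>p. nc_degree p \<le> d \<Longrightarrow> 0 \<le> Re (L (nc_star p * p))"
  obtains A \<xi> where "spherical_isometry N A" "\<xi> \<in> carrier_vec N"
    "\<And>w. length w \<le> d - 1 \<Longrightarrow> (word_eval N A w *\<^sub>v \<xi>) \<bullet>c \<xi> = L (Poly_Mapping.single w 1)"
proof -
  define s where "s p q = L (nc_star q * p)" for p q
  define V where "V e = {p :: 'g ncpoly. nc_degree p \<le> e}" for e
  have V_mono: "V (d - 1) \<subseteq> V d" by (auto simp: V_def)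
  have form: "psd_form smul (V e) s" if "e \<le> d" for e
  proof
    show "pm.subspace (V e)"
      by (rule pm.subspaceI) (auto simp: V_def nc_degree_add_le nc_degree_smul)
    show "s (x + y) z = s x z + s y z" for x y z by (simp add: s_def distrib_left L_add)
    show "s (smul c x) y = c * s x y" for c x y by (simp add: s_def smul_mult_right L_smul)
    show "s y x = cnj (s x y)" for x y by (simp add: s_def nc_star_mult flip: L_star)
    show "0 \<le> Re (s x x)" if "x \<in> V e" for x
      using that \<open>e \<le> d\<close> by (auto simp: s_def V_def intro: L_pos)
  qed
  interpret lower: psd_form smul "V (d - 1)" s by (rule form) simp
  interpret upper: psd_form smul "V d" s by (rule form) simp
  define X' where "X' x p = Poly_Mapping.single [x] 1 * p" for x and p :: "'g ncpoly"
  have X'_degree: "X' x p \<in> V d" if "p \<in> V (d - 1)" for x p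
    using that nc_degree_mult_le[of "Poly_Mapping.single [x] 1" 1 p "d - 1"] nc_degree_single[of "[x]" "1::complex"] d
    by (simp add: V_def X'_def)
  have X'_adjoint: "s (X' x p) q = s p (X' (letter_star x) q)" for x p q
    by (simp add: s_def X'_def nc_star_mult nc_star_single word_star_def mult.assoc)
  have X'_sum: "(\<Sum>j\<in>UNIV. s (X' (X j) p) (X' (X j) p)) = s p p" for p
  proof -
    have "nc_star p * p - (\<Sum>j\<in>UNIV. nc_star (X' (X j) p) * X' (X j) p) = nc_star p * spherical_relation * p"
      by (simp add: X'_def nc_star_mult nc_star_single word_star_def spherical_relation_def nc_gen_def
          algebra_simps sum_distrib_left sum_distrib_right)
    then have "nc_star p * p = nc_star p * spherical_relation * p + (\<Sum>j\<in>UNIV. nc_star (X' (X j) p) * X' (X j) p)"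
      by (simp add: algebra_simps)
    moreover have "L (nc_star p * spherical_relation * p) = 0"
      by (intro L_ideal spherical_ideal_mult_right spherical_ideal_mult_left spherical_relation_in_ideal)
    moreover have "L (sum h S) = (\<Sum>k\<in>S. L (h k))" for h and S :: "'g set"
      using L_smul[of 0 0] by (induction S rule: infinite_finite_induct) (auto simp: L_add)
    ultimately show ?thesis by (simp add: s_def L_add)
  qed
  obtain ws :: "'g letter list list" where ws: "distinct ws" "set ws = {w. length w \<le> d - 1}"
    using finite_distinct_list[OF finite_words_le] by blast
  have "set (map (\<lambda>w. Poly_Mapping.single w 1) ws) \<subseteq> V (d - 1)"
    using ws by (auto simp: V_def intro: order_trans[OF nc_degree_single])
  from lower.gram_schmidt[OF this] obtain m b where m_le: "m \<le> length ws" and b: "lower.orthonormal b m"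
    and gs: "\<And>w y. length w \<le> d - 1 \<Longrightarrow> y \<in> V (d - 1) \<Longrightarrow>
      s (Poly_Mapping.single w 1) y = (\<Sum>r<m. s (Poly_Mapping.single w 1) (b r) * s (b r) y)"
    using ws(2) by auto
  have bV: "b r \<in> V (d - 1)" if "r < m" for r using lower.orthonormalD(1)[OF b that] .
  have b': "upper.orthonormal b m"
    using b V_mono unfolding upper.orthonormal_def lower.orthonormal_def by blast
  have "length ws = card {w :: 'g letter list. length w \<le> d - 1}"
    using ws by (metis distinct_card)
  then have "2 * m \<le> N"
    using m_le card_words_le[where e = "d - 1", where 'g = 'g] N by linarith
  define M where "M = N - m"
  have mM: "m \<le> M" and N_eq: "N = m + M" using \<open>2 * m \<le> N\<close> by (auto simp: M_def)
  have expand_word: "s (Poly_Mapping.single w 1) y = (\<Sum>r<m. s (Poly_Mapping.single w 1) (b r) * s (b r) y)"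
    if w: "length w \<le> d - 1" and y: "y \<in> V d" for w y
  proof -
    let ?e = "lower.residual b m (Poly_Mapping.single w 1)"
    have e: "?e \<in> V (d - 1)"
      using w by (intro lower.residual_in_V[OF b]) (simp add: V_def order_trans[OF nc_degree_single])
    have null: "s ?e ?e = 0"
      by (subst (1) lower.s_residual_left) (simp only: gs[OF w e, symmetric] diff_self)
    have "s ?e y = 0"
      by (rule upper.null_vector[OF subsetD[OF V_mono e] y null])
    then show ?thesis unfolding lower.s_residual_left by (rule iffD1[OF right_minus_eq])
  qed
  have expand: "s p y = (\<Sum>r<m. s p (b r) * s (b r) y)" if p: "p \<in> V (d - 1)" and y: "y \<in> V d" for p y
  proof -
    have sp: "s p z = (\<Sum>w | length w \<le> d - 1. Poly_Mapping.lookup p w * s (Poly_Mapping.single w 1) z)" for z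
      using p by (subst poly_expand_words[of p "d - 1"]) (simp_all add: V_def lower.s_sum_left lower.s_scale_left)
    have "s p y = (\<Sum>w | length w \<le> d - 1. \<Sum>r<m. Poly_Mapping.lookup p w * s (Poly_Mapping.single w 1) (b r) * s (b r) y)"
      unfolding sp[of y] by (intro sum.cong refl) (simp add: expand_word[OF _ y] sum_distrib_left mult.assoc)
    also have "\<dots> = (\<Sum>r<m. s p (b r) * s (b r) y)"
      unfolding sp[of "b _"] sum_distrib_right by (rule sum.swap)
    finally show ?thesis .
  qed
  have parseval: "(\<Sum>r<m. (cmod (s p (b r)))\<^sup>2) = Re (s p p)" if "p \<in> V (d - 1)" for p
  proof -
    have "s p p = (\<Sum>r<m. complex_of_real ((cmod (s p (b r)))\<^sup>2))"
      unfolding complex_norm_square lower.s_hermitian[of "b _" p, symmetric]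
      using that V_mono by (intro expand) auto
    then show ?thesis by simp
  qed
  define a where "a j r k = s (X' (X j) (b k)) (b r)" for j r k
  have a_apply: "(\<Sum>k<m. a j r k * s p (b k)) = s (X' (X j) p) (b r)" if "p \<in> V (d - 1)" "r < m" for p r j
  proof -
    have "(\<Sum>k<m. a j r k * s p (b k)) = (\<Sum>k<m. s p (b k) * s (b k) (X' (XT j) (b r)))"
      by (simp add: a_def X'_adjoint mult.commute)
    also have "\<dots> = s p (X' (XT j) (b r))"
      using that by (intro expand[symmetric] X'_degree bV)
    finally show ?thesis by (simp add: X'_adjoint)
  qed
  have a_adjoint_apply: "(\<Sum>k<m. cnj (a j k r) * s p (b k)) = s (X' (XT j) p) (b r)"
    if "p \<in> V (d - 1)" "r < m" for p r j
  proof -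
    have "(\<Sum>k<m. cnj (a j k r) * s p (b k)) = (\<Sum>k<m. s p (b k) * s (b k) (X' (X j) (b r)))"
      by (simp add: a_def lower.s_hermitian[of "b _" "X' _ _"] mult.commute)
    also have "\<dots> = s p (X' (X j) (b r))"
      using that by (intro expand[symmetric] X'_degree bV)
    finally show ?thesis by (simp add: X'_adjoint)
  qed
  have "\<exists>D. defect_factor m a D"
  proof (rule defect_factor_exists)
    fix h :: "nat \<Rightarrow> complex"
    define p where "p = (\<Sum>k<m. smul (h k) (b k))"
    have p: "p \<in> V (d - 1)"
      unfolding p_def using bV
      by (intro pm.subspace_sum[OF lower.subspace_V] pm.subspace_scale[OF lower.subspace_V]) auto
    have coord: "s p (b r) = h r" if "r < m" for r
    proof -
      have "s p (b r) = (\<Sum>k<m. if k = r then h r else 0)"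
        unfolding p_def lower.s_sum_left lower.s_scale_left
        using lower.orthonormalD(2)[OF b _ that] by (intro sum.cong) auto
      then show ?thesis using that by simp
    qed
    have "(\<Sum>j\<in>UNIV. \<Sum>r<m. (cmod (\<Sum>k<m. a j r k * h k))\<^sup>2) =
        (\<Sum>j\<in>UNIV. \<Sum>r<m. (cmod (s (X' (X j) p) (b r)))\<^sup>2)"
    proof (intro sum.cong refl)
      fix j :: 'g and r assume r: "r \<in> {..<m}"
      have "(\<Sum>k<m. a j r k * h k) = (\<Sum>k<m. a j r k * s p (b k))"
        by (intro sum.cong) (auto simp: coord)
      then show "(cmod (\<Sum>k<m. a j r k * h k))\<^sup>2 = (cmod (s (X' (X j) p) (b r)))\<^sup>2"
        using a_apply[OF p, of r j] r by simp
    qed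
    also have "\<dots> \<le> (\<Sum>j\<in>UNIV. Re (s (X' (X j) p) (X' (X j) p)))"
      by (intro sum_mono upper.bessel[OF b'] X'_degree p)
    also have "\<dots> = Re (s p p)" by (simp flip: Re_sum add: X'_sum)
    also have "\<dots> = (\<Sum>k<m. (cmod (h k))\<^sup>2)"
      unfolding parseval[OF p, symmetric] by (intro sum.cong) (auto simp: coord)
    finally show "(\<Sum>j\<in>UNIV. \<Sum>r<m. (cmod (\<Sum>k<m. a j r k * h k))\<^sup>2) \<le> (\<Sum>k<m. (cmod (h k))\<^sup>2)" .
  qed
  then obtain D where D: "defect_factor m a D" ..
  let ?A = "dilation m M i j a D"
  define \<phi> where "\<phi> p = block_vec m M (\<lambda>r. s p (b r)) (\<lambda>_. 0)" for p
  have D_zero: "(\<Sum>k<m. D r k * s p (b k)) = 0"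
    if p: "p \<in> V (d - 1)" and Xp: "\<And>j. X' (X j) p \<in> V (d - 1)" and r: "r < m" for p r
  proof -
    have "(\<Sum>j\<in>UNIV. \<Sum>r<m. (cmod (\<Sum>k<m. a j r k * s p (b k)))\<^sup>2) = (\<Sum>j\<in>UNIV. Re (s (X' (X j) p) (X' (X j) p)))"
      unfolding parseval[OF Xp, symmetric] by (intro sum.cong refl) (simp add: a_apply[OF p])
    also have "\<dots> = Re (s p p)" by (simp flip: Re_sum add: X'_sum)
    finally have "(\<Sum>r<m. (cmod (\<Sum>k<m. D r k * s p (b k)))\<^sup>2) = 0"
      using defect_factor_norm[OF D, of "\<lambda>k. s p (b k)"] parseval[OF p] by simp
    then have "(cmod (\<Sum>k<m. D r k * s p (b k)))\<^sup>2 = 0"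
      using r by (subst (asm) sum_nonneg_eq_0_iff) auto
    then show ?thesis by simp
  qed
  have orbit: "word_eval N ?A w *\<^sub>v \<phi> 1 = \<phi> (Poly_Mapping.single w 1)" if "length w \<le> d - 1" for w
    using that
  proof (induction w)
    case Nil
    show ?case
      by (simp add: word_eval_Nil N_eq \<phi>_def one_mult_mat_vec[OF block_vec_carrier] flip: one_eq_single_Nil)
  next
    case (Cons x w)
    have carr: "\<And>j. ?A j \<in> carrier_mat N N" by (simp add: N_eq)
    let ?p = "Poly_Mapping.single w (1 :: complex)"
    have Xp_eq: "X' y ?p = Poly_Mapping.single (y # w) 1" for y
      by (simp add: X'_def mult_single plus_list_def)
    have p: "?p \<in> V (d - 1)" and Xp: "\<And>y. X' y ?p \<in> V (d - 1)"
      using Cons.prems unfolding Xp_eq by (simp_all add: V_def order_trans[OF nc_degree_single])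
    have "word_eval N ?A (x # w) *\<^sub>v \<phi> 1 = letter_eval ?A x *\<^sub>v (word_eval N ?A w *\<^sub>v \<phi> 1)"
      unfolding word_eval_Cons
      by (rule assoc_mult_mat_vec[OF letter_eval_carrier[OF carr] word_eval_carrier[OF carr]])
         (simp add: \<phi>_def N_eq)
    also have "word_eval N ?A w *\<^sub>v \<phi> 1 = \<phi> ?p" using Cons by simp
    also have "letter_eval ?A x *\<^sub>v \<phi> ?p = \<phi> (X' x ?p)"
    proof (cases x)
      case (X l)
      have "?A l *\<^sub>v \<phi> ?p = \<phi> (X' (X l) ?p)"
        unfolding \<phi>_def dilation_block_vec using D_zero[OF p Xp]
        by (intro block_vec_cong) (simp_all add: a_apply[OF p])
      then show ?thesis by (simp add: X)
    next
      case (XT l)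
      have "mat_adjoint (?A l) *\<^sub>v \<phi> ?p = \<phi> (X' (XT l) ?p)"
        unfolding \<phi>_def adjoint_dilation_block_vec[OF mM]
        by (intro block_vec_cong) (simp_all add: a_adjoint_apply[OF p])
      then show ?thesis by (simp add: XT)
    qed
    finally show ?case by (simp add: Xp_eq)
  qed
  have "(word_eval N ?A w *\<^sub>v \<phi> 1) \<bullet>c \<phi> 1 = L (Poly_Mapping.single w 1)" if w: "length w \<le> d - 1" for w
  proof -
    have one: "(1 :: 'g ncpoly) \<in> V d" "nc_star 1 = (1 :: 'g ncpoly)"
      unfolding one_eq_single_Nil V_def
      by (simp_all add: nc_star_single word_star_def nc_degree_le_iff)
    have "(word_eval N ?A w *\<^sub>v \<phi> 1) \<bullet>c \<phi> 1 = (\<Sum>r<m + M. \<phi> (Poly_Mapping.single w 1) $ r * cnj (\<phi> 1 $ r))"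
      unfolding orbit[OF w] by (simp add: \<phi>_def scalar_prod_def lessThan_atLeast0 carrier_vecD[OF block_vec_carrier])
    also have "\<dots> = (\<Sum>r<m. s (Poly_Mapping.single w 1) (b r) * s (b r) 1)"
      unfolding sum_lessThan_add \<phi>_def lower.s_hermitian[of "b _" 1] by simp
    also have "\<dots> = s (Poly_Mapping.single w 1) 1"
      by (rule expand_word[OF w one(1), symmetric])
    finally show ?thesis by (simp add: s_def one)
  qed
  moreover have "spherical_isometry N ?A"
    unfolding N_eq by (rule spherical_isometry_dilation[OF mM ij D])
  moreover have "\<phi> 1 \<in> carrier_vec N" by (simp add: \<phi>_def N_eq)
  ultimately show ?thesis using that by blast
qed

section \<open>The Positivstellensatz on spherical isometries\<close>

theorem theorem1p5:
  fixes f :: "'g::finite ncpoly" and d :: nat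
  assumes "CARD('g) \<ge> 2"
    and "d \<ge> 1"
    and "nc_degree f = d - 1"
    and "nc_nonneg_on ((2 * CARD('g) + 1) ^ d)
           {A. spherical_isometry ((2 * CARD('g) + 1) ^ d) A} f"
  shows "\<exists>(ps :: 'g ncpoly list) q.
           (\<forall>p\<in>set ps. nc_degree p \<le> d)
           \<and> q \<in> spherical_ideal
           \<and> f = (\<Sum>p\<leftarrow>ps. nc_star p * p) + q"
proof (rule ccontr)
  assume contra: "\<not> ?thesis"
  define N where "N = (2 * CARD('g) + 1) ^ d"
  have "\<exists>i j :: 'g. i \<noteq> j"
  proof (rule ccontr)
    assume "\<nexists>i j :: 'g. i \<noteq> j"
    then have "CARD('g) \<le> Suc 0" by (subst card_le_Suc0_iff_eq) auto
    then show False using assms(1) by simp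
  qed
  then obtain i j :: 'g where ij: "i \<noteq> j" by blast
  interpret two_indices i j by standard (rule ij)
  have N_ge: "2 * (2 * CARD('g) + 1) ^ (d - 1) \<le> N"
  proof -
    have "N = (2 * CARD('g) + 1) * (2 * CARD('g) + 1) ^ (d - 1)"
      using assms(2) by (simp add: N_def power_eq_if)
    moreover have "2 * (2 * CARD('g) + 1) ^ (d - 1) \<le> (2 * CARD('g) + 1) * (2 * CARD('g) + 1) ^ (d - 1)"
      using assms(1) by (intro mult_right_mono) auto
    ultimately show ?thesis by simp
  qed
  have N_ge': "2 * ((d - 1) + 1) \<le> N"
  proof -
    have "d - 1 < 2 ^ (d - 1)" by (rule less_exp)
    also have "\<dots> \<le> (2 * CARD('g) + 1) ^ (d - 1)"
      using assms(1) by (intro power_mono) auto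
    finally have "d - 1 + 1 \<le> (2 * CARD('g) + 1) ^ (d - 1)" by simp
    then have "2 * (d - 1 + 1) \<le> 2 * (2 * CARD('g) + 1) ^ (d - 1)" by (rule mult_left_mono) simp
    then show ?thesis using N_ge by (rule order_trans)
  qed
  have nonneg: "psd_mat N (nc_eval N A f)" if "spherical_isometry N A" for A
    using assms(4) that by (simp add: nc_nonneg_on_def N_def)
  have symmetric: "f - nc_star f \<in> spherical_ideal"
  proof -
    let ?h = "f - nc_star f"
    have "nf ?h = 0"
    proof (rule normal_poly_detected[OF _ N_ge'])
      show "nf ?h \<in> normal_polys i (d - 1)"
        using assms(3) by (intro nf_degree nc_degree_diff_le) auto
      fix A :: "'g \<Rightarrow> complex mat" and \<xi> :: "complex vec"
      assume A: "spherical_isometry N A" and \<xi>: "\<xi> \<in> carrier_vec N"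
      have carr: "\<And>j. A j \<in> carrier_mat N N" using spherical_isometryD(1)[OF A] .
      have N0: "0 < N" by (simp add: N_def)
      let ?F = "\<lambda>w. (word_eval N A w *\<^sub>v \<xi>) $ 0"
      have "nc_eval N A (nc_star f) = nc_eval N A f"
        using nonneg[OF A] by (simp add: nc_eval_star[OF carr] psd_mat_def)
      then have "lin ?F (nc_star f) = lin ?F f"
        using nc_eval_vec_index[where A = A, OF carr N0 \<xi>] by metis
      moreover have "lin ?F (nf ?h) = lin ?F ?h"
        using lin_spherical_ideal(1)[OF A nf_congruent[of ?h] \<xi> N0] by (simp add: lin_diff)
      ultimately show "lin ?F (nf ?h) = 0" by (simp add: lin_diff)
    qed
    then show ?thesis using nf_congruent[of ?h] by simp
  qed
  have outside: "f - c \<notin> spherical_ideal" if c: "c \<in> sos_cone d" for c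
  proof
    assume "f - c \<in> spherical_ideal"
    moreover have "f = c + (f - c)" by simp
    ultimately show False using c contra unfolding sos_cone_def by blast
  qed
  have "nc_degree f \<le> 2 * d" using assms(3) by simp
  from sos_separation[OF this outside]
  obtain L where L_add: "\<And>p q. L (p + q) = L p + L q" and L_smul: "\<And>c p. L (smul c p) = c * L p"
    and L_ideal: "\<And>p. p \<in> spherical_ideal \<Longrightarrow> L p = 0"
    and L_pos: "\<And>p. nc_degree p \<le> d \<Longrightarrow> 0 \<le> Re (L (nc_star p * p))" and L_f: "Re (L f) < 0"
    by blast
  \<comment> \<open>The symmetrised functional is Hermitian and agrees with \<open>Re (L f)\<close> at \<open>f\<close>, because \<open>f\<close> and \<open>nc_star f\<close> are congruent.\<close>
  define H where "H p = (L p + cnj (L (nc_star p))) / 2" for p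
  have H_add: "H (p + q) = H p + H q" for p q
    by (simp add: H_def nc_star_add L_add add_divide_distrib)
  have H_smul: "H (smul c p) = c * H p" for c p
    by (simp add: H_def nc_star_smul L_smul algebra_simps add_divide_distrib)
  have H_ideal: "H p = 0" if "p \<in> spherical_ideal" for p
    using that by (simp add: H_def L_ideal nc_star_in_ideal)
  have H_star: "H (nc_star p) = cnj (H p)" for p
    by (simp add: H_def add.commute)
  have H_pos: "0 \<le> Re (H (nc_star p * p))" if "nc_degree p \<le> d" for p
    using L_pos[OF that] by (simp add: H_def nc_star_mult)
  obtain A \<xi> where A: "spherical_isometry N A" and \<xi>: "\<xi> \<in> carrier_vec N"
    and moments: "\<And>w. length w \<le> d - 1 \<Longrightarrow> (word_eval N A w *\<^sub>v \<xi>) \<bullet>c \<xi> = H (Poly_Mapping.single w 1)"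
    using gns_spherical_isometry[where L = H, OF ij assms(2) N_ge H_add H_smul H_ideal H_star H_pos] by metis
  have carr: "\<And>j. A j \<in> carrier_mat N N" using spherical_isometryD(1)[OF A] .
  have H_sum: "H (sum h S) = (\<Sum>k\<in>S. H (h k))" for h and S :: "'g letter list set"
    using H_smul[of 0 0] by (induction S rule: infinite_finite_induct) (auto simp: H_add)
  have "(nc_eval N A f *\<^sub>v \<xi>) \<bullet>c \<xi> = lin (\<lambda>w. (word_eval N A w *\<^sub>v \<xi>) \<bullet>c \<xi>) f"
    by (rule nc_eval_inner[OF carr \<xi> \<xi>])
  also have "\<dots> = (\<Sum>w\<in>Poly_Mapping.keys f. H (smul (Poly_Mapping.lookup f w) (Poly_Mapping.single w 1)))"
    unfolding lin_def H_smul using assms(3) nc_degree_le_iff[of f "d - 1"]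
    by (intro sum.cong refl) (simp add: moments)
  also have "\<dots> = H f"
    unfolding H_sum[symmetric] smul_single mult_1_right poly_mapping_expand[symmetric] ..
  finally have "0 \<le> Re (H f)"
    using nonneg[OF A] \<xi> by (auto simp: psd_mat_def)
  moreover have "L (nc_star f) = L f"
  proof -
    have "L (f - nc_star f + nc_star f) = L (nc_star f)"
      unfolding L_add L_ideal[OF symmetric] by simp
    then show ?thesis by simp
  qed
  then have "Re (H f) = Re (L f)" by (simp add: H_def)
  ultimately show False using L_f by simp
qed

end
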